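(* There are surjections $\phi:F_2\to G$ onto finite groups $G$ with the following two properties: (i) the group $G$ acts freely and linearly on a sphere $S^N$; (ii) no primitive element of $F_2$ is contained in the kernel of $\phi$. In particular, for the associated cover $Y\to X$ of a graph $X$ with $\pi_1(X)=F_2$, we have $H_1^{\mathrm{prim}}(Y;\mathbb{C})\neq H_1(Y;\mathbb{C})$.
   Context: $F_2$ is the free group of rank $2$; an element is primitive if it is part of a free basis. The cover associated to a surjection $\phi:\pi_1(X)\to G$ is the connected regular cover $Y\to X$ with $\pi_1(Y)=\ker\phi$ and deck group $G$. A free linear action on a sphere is one induced by a linear representation of $G$ preserving the unit sphere in which no non-identity element fixes a point of the sphere. Fix a basepoint $x_0\in X$ and a lift $\hat x_0\in Y$. For a loop $\gamma$ in $X$ at $x_0$, the preferred elevation is the lift at $\hat x_0$ of the smallest power $\gamma^k$ ($k\ge1$) that lifts to a closed loop in $Y$; its images under deck transformations are the elevations of $\gamma$. The primitive homology $H_1^{\mathrm{prim}}(Y;\mathbb{C})\subseteq H_1(Y;\mathbb{C})$ is the $\mathbb{C}$-span of the homology classes of all elevations of loops representing primitive elements of $\pi_1(X)$. *)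

theory Defs
  imports "HOL-Homology.Homology" "HOL-Algebra.Group_Action"
begin

section \<open>Free groups and primitive elements\<close>

text \<open>A word over \<open>B\<close> is a list of pairs \<open>(x, s)\<close>, where \<open>s\<close> tells whether the letter is
  \<open>x\<close> (\<open>s = True\<close>) or its inverse (\<open>s = False\<close>).\<close>

primrec word_value :: "('a, 'm) monoid_scheme \<Rightarrow> ('a \<times> bool) list \<Rightarrow> 'a" where
  "word_value G [] = \<one>\<^bsub>G\<^esub>"
| "word_value G (l # w) =
     (if snd l then fst l else inv\<^bsub>G\<^esub> (fst l)) \<otimes>\<^bsub>G\<^esub> word_value G w"

definition reduced_word :: "('a \<times> bool) list \<Rightarrow> bool" where
  "reduced_word w \<longleftrightarrow> successively (\<lambda>l m. \<not> (fst l = fst m \<and> snd l \<noteq> snd m)) w"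

definition free_basis :: "('a, 'm) monoid_scheme \<Rightarrow> 'a set \<Rightarrow> bool" where
  "free_basis G B \<longleftrightarrow>
     B \<subseteq> carrier G \<and> generate G B = carrier G \<and>
     (\<forall>w. w \<noteq> [] \<and> fst ` set w \<subseteq> B \<and> reduced_word w \<longrightarrow> word_value G w \<noteq> \<one>\<^bsub>G\<^esub>)"

definition free_group_of_rank :: "('a, 'm) monoid_scheme \<Rightarrow> nat \<Rightarrow> bool" where
  "free_group_of_rank G n \<longleftrightarrow> group G \<and> (\<exists>B. free_basis G B \<and> finite B \<and> card B = n)"

definition primitive_element :: "('a, 'm) monoid_scheme \<Rightarrow> 'a \<Rightarrow> bool" where
  "primitive_element G x \<longleftrightarrow> (\<exists>B. free_basis G B \<and> x \<in> B)"


section \<open>Free linear actions on spheres\<close>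

text \<open>\<open>Euclidean_space (Suc N)\<close> models \<open>\<real>\<^sup>N\<^sup>+\<^sup>1\<close> by the functions \<open>nat \<Rightarrow> real\<close> that vanish at all
  indices above \<open>N\<close>; its unit sphere is the library's \<open>nsphere N\<close>.\<close>

definition linear_representation ::
    "('g, 'm) monoid_scheme \<Rightarrow> nat \<Rightarrow> ('g \<Rightarrow> (nat \<Rightarrow> real) \<Rightarrow> (nat \<Rightarrow> real)) \<Rightarrow> bool" where
  "linear_representation G n \<rho> \<longleftrightarrow>
     group_action G (topspace (Euclidean_space n)) \<rho> \<and>
     (\<forall>g \<in> carrier G. \<forall>a b. \<forall>x \<in> topspace (Euclidean_space n). \<forall>y \<in> topspace (Euclidean_space n).
        \<rho> g (\<lambda>i. a * x i + b * y i) = (\<lambda>i. a * \<rho> g x i + b * \<rho> g y i))"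

definition acts_freely_linearly_on_sphere :: "('g, 'm) monoid_scheme \<Rightarrow> nat \<Rightarrow> bool" where
  "acts_freely_linearly_on_sphere G N \<longleftrightarrow>
     (\<exists>\<rho>. linear_representation G (Suc N) \<rho> \<and>
          (\<forall>g \<in> carrier G. \<rho> g ` topspace (nsphere N) \<subseteq> topspace (nsphere N)) \<and>
          (\<forall>g \<in> carrier G. g \<noteq> \<one>\<^bsub>G\<^esub> \<longrightarrow> (\<forall>x \<in> topspace (nsphere N). \<rho> g x \<noteq> x)))"


section \<open>Graphs\<close>

text \<open>A (topological) graph is a one-dimensional CW complex. \<open>V\<close> is the set of vertices, and
  \<open>E\<close> consists of one characteristic map \<open>[0,1] \<rightarrow> X\<close> for every edge. The last condition is the
  weak topology: it makes \<open>X\<close> the topological quotient of the disjoint union of the discrete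
  space \<open>V\<close> and copies of \<open>[0,1]\<close>. No finiteness is assumed.\<close>

definition is_graph :: "'a::topological_space set \<Rightarrow> bool" where
  "is_graph X \<longleftrightarrow> (\<exists>V (E :: (real \<Rightarrow> 'a) set).
     (\<forall>e \<in> E. continuous_on {0..1} e \<and> e ` {0..1} \<subseteq> X \<and> e 0 \<in> V \<and> e 1 \<in> V \<and>
              inj_on e {0<..<1} \<and> e ` {0<..<1} \<inter> V = {}) \<and>
     (\<forall>e \<in> E. \<forall>e' \<in> E. e \<noteq> e' \<longrightarrow> e ` {0<..<1} \<inter> e' ` {0<..<1} = {}) \<and>
     X = V \<union> (\<Union>e \<in> E. e ` {0<..<1}) \<and>
     (\<forall>A \<subseteq> X. (\<forall>e \<in> E. closed {t \<in> {0..1}. e t \<in> A}) \<longrightarrow> closedin (top_of_set X) A))"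


section \<open>The fundamental group\<close>

definition loops_at :: "'a::topological_space set \<Rightarrow> 'a \<Rightarrow> (real \<Rightarrow> 'a) set" where
  "loops_at X x0 = {\<gamma>. path \<gamma> \<and> path_image \<gamma> \<subseteq> X \<and> pathstart \<gamma> = x0 \<and> pathfinish \<gamma> = x0}"

definition homotopy_class :: "'a::topological_space set \<Rightarrow> (real \<Rightarrow> 'a) \<Rightarrow> (real \<Rightarrow> 'a) set" where
  "homotopy_class X \<gamma> = {\<delta>. homotopic_paths X \<gamma> \<delta>}"

definition fundamental_group ::
    "'a::topological_space set \<Rightarrow> 'a \<Rightarrow> (real \<Rightarrow> 'a) set monoid" where
  "fundamental_group X x0 =
     \<lparr>carrier = homotopy_class X ` loops_at X x0,
      mult = (\<lambda>A B. \<Union>\<gamma> \<in> A. \<Union>\<delta> \<in> B. homotopy_class X (\<gamma> +++ \<delta>)),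
      one = homotopy_class X (\<lambda>t. x0)\<rparr>"

primrec loop_power :: "(real \<Rightarrow> 'a::topological_space) \<Rightarrow> nat \<Rightarrow> real \<Rightarrow> 'a" where
  "loop_power \<gamma> 0 = (\<lambda>t. pathstart \<gamma>)"
| "loop_power \<gamma> (Suc k) = \<gamma> +++ loop_power \<gamma> k"


section \<open>Covers and elevations\<close>

text \<open>\<open>p: (Y, y0) \<rightarrow> (X, x0)\<close> is the connected based cover with \<open>p\<^sub>* \<pi>\<^sub>1(Y, y0) = ker \<psi>\<close>. As a
  kernel is normal, this cover is regular; for surjective \<open>\<psi>\<close> its deck group is \<open>G\<close>.\<close>

definition associated_cover ::
    "'a::topological_space set \<Rightarrow> 'a \<Rightarrow> ('g, 'm) monoid_scheme \<Rightarrow> ((real \<Rightarrow> 'a) set \<Rightarrow> 'g) \<Rightarrow>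
     'b::topological_space set \<Rightarrow> ('b \<Rightarrow> 'a) \<Rightarrow> 'b \<Rightarrow> bool" where
  "associated_cover X x0 G \<psi> Y p y0 \<longleftrightarrow>
     covering_space Y p X \<and> connected Y \<and> y0 \<in> Y \<and> p y0 = x0 \<and>
     (\<lambda>\<delta>. homotopy_class X (p \<circ> \<delta>)) ` loops_at Y y0 = kernel (fundamental_group X x0) G \<psi>"

definition closed_lift ::
    "'b::topological_space set \<Rightarrow> ('b \<Rightarrow> 'a::topological_space) \<Rightarrow> 'b \<Rightarrow>
     (real \<Rightarrow> 'a) \<Rightarrow> (real \<Rightarrow> 'b) \<Rightarrow> bool" where
  "closed_lift Y p y0 \<gamma> \<delta> \<longleftrightarrow> \<delta> \<in> loops_at Y y0 \<and> (\<forall>t \<in> {0..1}. p (\<delta> t) = \<gamma> t)"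

definition preferred_elevation ::
    "'b::topological_space set \<Rightarrow> ('b \<Rightarrow> 'a::topological_space) \<Rightarrow> 'b \<Rightarrow>
     (real \<Rightarrow> 'a) \<Rightarrow> (real \<Rightarrow> 'b) \<Rightarrow> bool" where
  "preferred_elevation Y p y0 \<gamma> \<delta> \<longleftrightarrow>
     (\<exists>k \<ge> 1. closed_lift Y p y0 (loop_power \<gamma> k) \<delta> \<and>
             (\<forall>j. 1 \<le> j \<and> j < k \<longrightarrow> \<not> (\<exists>\<delta>'. closed_lift Y p y0 (loop_power \<gamma> j) \<delta>')))"

definition deck_transformation ::
    "'b::topological_space set \<Rightarrow> ('b \<Rightarrow> 'a) \<Rightarrow> ('b \<Rightarrow> 'b) \<Rightarrow> bool" where
  "deck_transformation Y p \<tau> \<longleftrightarrow>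
     (\<exists>\<sigma>. homeomorphism Y Y \<tau> \<sigma>) \<and> (\<forall>y \<in> Y. p (\<tau> y) = p y)"

definition elevation ::
    "'b::topological_space set \<Rightarrow> ('b \<Rightarrow> 'a::topological_space) \<Rightarrow> 'b \<Rightarrow>
     (real \<Rightarrow> 'a) \<Rightarrow> (real \<Rightarrow> 'b) \<Rightarrow> bool" where
  "elevation Y p y0 \<gamma> \<epsilon> \<longleftrightarrow>
     (\<exists>\<tau> \<delta>. deck_transformation Y p \<tau> \<and> preferred_elevation Y p y0 \<gamma> \<delta> \<and> \<epsilon> = \<tau> \<circ> \<delta>)"


section \<open>Singular homology with complex coefficients\<close>

text \<open>The library's singular chains have integer coefficients. The following is the same
  construction over \<open>\<complex>\<close>, on the library's singular simplices and faces.\<close>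

type_synonym 'a complex_chain = "((nat \<Rightarrow> real) \<Rightarrow> 'a) \<Rightarrow>\<^sub>0 complex"

definition complex_chains :: "nat \<Rightarrow> 'a topology \<Rightarrow> 'a complex_chain set" where
  "complex_chains n T = {c. Poly_Mapping.keys c \<subseteq> singular_simplex_set n T}"

definition complex_boundary :: "nat \<Rightarrow> 'a complex_chain \<Rightarrow> 'a complex_chain" where
  "complex_boundary n c =
     (if n = 0 then 0
      else (\<Sum>f \<in> Poly_Mapping.keys c. \<Sum>k\<le>n.
              Poly_Mapping.single (singular_face n k f) ((-1) ^ k * Poly_Mapping.lookup c f)))"

definition complex_cycles :: "nat \<Rightarrow> 'a topology \<Rightarrow> 'a complex_chain set" where
  "complex_cycles n T = {c \<in> complex_chains n T. complex_boundary n c = 0}"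

definition complex_boundaries :: "nat \<Rightarrow> 'a topology \<Rightarrow> 'a complex_chain set" where
  "complex_boundaries n T = complex_boundary (Suc n) ` complex_chains (Suc n) T"

definition homology_class ::
    "nat \<Rightarrow> 'a topology \<Rightarrow> 'a complex_chain \<Rightarrow> 'a complex_chain set" where
  "homology_class n T z = {w \<in> complex_cycles n T. w - z \<in> complex_boundaries n T}"

definition complex_homology :: "nat \<Rightarrow> 'a topology \<Rightarrow> 'a complex_chain set set" where
  "complex_homology n T = homology_class n T ` complex_cycles n T"

definition homology_add ::
    "nat \<Rightarrow> 'a topology \<Rightarrow> 'a complex_chain set \<Rightarrow> 'a complex_chain set \<Rightarrow> 'a complex_chain set" where
  "homology_add n T A B = (\<Union>z \<in> A. \<Union>w \<in> B. homology_class n T (z + w))"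

definition homology_scale ::
    "nat \<Rightarrow> 'a topology \<Rightarrow> complex \<Rightarrow> 'a complex_chain set \<Rightarrow> 'a complex_chain set" where
  "homology_scale n T a A = (\<Union>z \<in> A. homology_class n T (Poly_Mapping.map ((*) a) z))"

text \<open>The \<open>\<complex>\<close>-linear span of a set \<open>S\<close> of homology classes:\<close>

inductive_set homology_span ::
    "nat \<Rightarrow> 'a topology \<Rightarrow> 'a complex_chain set set \<Rightarrow> 'a complex_chain set set"
  for n :: nat and T :: "'a topology" and S :: "'a complex_chain set set" where
  span_zero: "homology_class n T 0 \<in> homology_span n T S"
| span_base: "A \<in> S \<Longrightarrow> A \<in> homology_span n T S"
| span_add: "A \<in> homology_span n T S \<Longrightarrow> B \<in> homology_span n T S \<Longrightarrow>
    homology_add n T A B \<in> homology_span n T S"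
| span_scale: "A \<in> homology_span n T S \<Longrightarrow> homology_scale n T a A \<in> homology_span n T S"

text \<open>A loop as a singular cycle: \<open>x 1\<close> is the coordinate of \<open>standard_simplex 1\<close> that runs
  from \<open>0\<close> to \<open>1\<close> between its two vertices.\<close>

definition loop_cycle :: "(real \<Rightarrow> 'a) \<Rightarrow> 'a complex_chain" where
  "loop_cycle \<delta> = Poly_Mapping.single (restrict (\<lambda>x. \<delta> (x 1)) (standard_simplex 1)) 1"

definition primitive_homology ::
    "'a::topological_space set \<Rightarrow> 'a \<Rightarrow> 'b::topological_space set \<Rightarrow> ('b \<Rightarrow> 'a) \<Rightarrow> 'b \<Rightarrow>
     'b complex_chain set set" where
  "primitive_homology X x0 Y p y0 =
     homology_span 1 (top_of_set Y)
       {homology_class 1 (top_of_set Y) (loop_cycle \<epsilon>) | \<epsilon> \<gamma>.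
          \<gamma> \<in> loops_at X x0 \<and>
          primitive_element (fundamental_group X x0) (homotopy_class X \<gamma>) \<and>
          elevation Y p y0 \<gamma> \<epsilon>}"

end

theory Submission
  imports Defs
begin

text \<open>Let \<open>F\<close> be free of rank two and \<open>\<phi>: F \<rightarrow> G\<close> a surjection with kernel \<open>K\<close>.

  If \<open>K\<close> contains a member \<open>x\<close> of a free basis \<open>{x, y}\<close>, then \<open>\<phi> y\<close> generates \<open>G\<close>
  (\<open>primitive_not_in_kernel\<close>). So every finite nonabelian two-generator group that acts freely
  and linearly on a sphere is an example. The quaternion group of order eight is one: it acts on the
  3-sphere by left multiplication of unit quaternions (\<open>quaternion_group_acts_freely\<close>).

  For the statement on homology, let \<open>G\<close> act on \<open>E = \<real>\<^sup>N\<^sup>+\<^sup>1\<close> so that non-identity elements fix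
  only the zero vector, and let \<open>c: F \<rightarrow> E\<close> be a crossed homomorphism,
  \<open>c (x y) = c x + \<phi> x \<cdot> c y\<close>. Its restriction to \<open>K\<close> is a homomorphism. Whenever \<open>\<phi> x\<close> is not
  the identity and \<open>x\<^sup>k\<close> lies in \<open>K\<close>, the vector \<open>c (x\<^sup>k)\<close> is fixed by \<open>\<phi> x\<close> and so is zero
  (\<open>c_power_zero\<close>). As no primitive element lies in \<open>K\<close>, this covers the powers of all primitive
  elements and of their conjugates, which are what the elevations of primitive loops represent in
  \<open>K\<close>, the fundamental group of \<open>Y\<close>. Hence each coordinate of \<open>c\<close>, extended to a linear functional
  on homology (\<open>loop_functional\<close>), kills the primitive homology.

  It remains to find \<open>c\<close> that is not zero on \<open>K\<close>. Freeness of \<open>F\<close> on \<open>{a, b}\<close> allows \<open>c a = 0\<close> and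
  \<open>c b \<noteq> 0\<close> (\<open>exists_crossed_homomorphism\<close>). If \<open>c\<close> were zero on \<open>K\<close>, it would factor through the
  finite group \<open>G\<close>, and averaging would give a vector \<open>v\<close> with \<open>c x = v - \<phi> x \<cdot> v\<close> up to a scalar;
  then \<open>\<phi> a\<close> fixes \<open>v\<close>, so \<open>v = 0\<close> and \<open>c = 0\<close>, a contradiction
  (\<open>vanishing_on_kernel_imp_zero\<close>).\<close>

section \<open>Free bases\<close>

definition inverse_word :: "('a \<times> bool) list \<Rightarrow> ('a \<times> bool) list" where
  "inverse_word w = rev (map (apsnd Not) w)"

lemma fst_set_inverse_word [simp]: "fst ` set (inverse_word w) = fst ` set w"
  by (force simp: inverse_word_def)

lemma fst_set_map_apfst [simp]: "fst ` set (map (apfst f) w) = f ` fst ` set w"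
  by force

lemma inverse_word_map_apfst: "inverse_word (map (apfst f) w) = map (apfst f) (inverse_word w)"
  by (simp add: inverse_word_def rev_map)

lemma not_reduced_word_splits:
  assumes "\<not> reduced_word w"
  shows "\<exists>u x s v. w = u @ (x, s) # (x, \<not> s) # v"
  using assms
proof (induction w)
  case Nil
  then show ?case by (simp add: reduced_word_def)
next
  case (Cons l w)
  show ?case
  proof (cases "reduced_word w")
    case False
    with Cons.IH obtain u x s v where "w = u @ (x, s) # (x, \<not> s) # v"
      by blast
    then have "l # w = (l # u) @ (x, s) # (x, \<not> s) # v"
      by simp
    then show ?thesis by blast
  next
    case True
    with Cons.prems obtain m v where "w = m # v" "fst l = fst m" "snd l \<noteq> snd m"
      by (cases w) (auto simp: reduced_word_def)
    then have "l # w = [] @ (fst l, snd l) # (fst l, \<not> snd l) # v"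
      by (cases l; cases m) auto
    then show ?thesis by blast
  qed
qed

context group
begin

lemma word_value_closed [simp]:
  "fst ` set w \<subseteq> carrier G \<Longrightarrow> word_value G w \<in> carrier G"
  by (induction w) auto

lemma word_value_append:
  "fst ` set u \<subseteq> carrier G \<Longrightarrow> fst ` set v \<subseteq> carrier G \<Longrightarrow>
    word_value G (u @ v) = word_value G u \<otimes> word_value G v"
  by (induction u) (auto simp: m_assoc)

lemma word_value_inverse_word:
  assumes "fst ` set w \<subseteq> carrier G"
  shows "word_value G (inverse_word w) = inv (word_value G w)"
  using assms
proof (induction w)
  case Nil
  then show ?case by (simp add: inverse_word_def)
next
  case (Cons l w)
  have "word_value G (inverse_word (l # w)) = word_value G (inverse_word w @ [apsnd Not l])"
    by (simp add: inverse_word_def)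
  also have "\<dots> = word_value G (inverse_word w) \<otimes> word_value G [apsnd Not l]"
    using Cons.prems by (subst word_value_append) auto
  also have "\<dots> = inv (word_value G (l # w))"
    using Cons by (auto simp: inv_mult_group)
  finally show ?case .
qed

lemma word_value_cancel:
  assumes "fst ` set (u @ (x, s) # (x, \<not> s) # v) \<subseteq> carrier G"
  shows "word_value G (u @ (x, s) # (x, \<not> s) # v) = word_value G (u @ v)"
proof -
  have "word_value G ((x, s) # (x, \<not> s) # v) = word_value G v"
    using assms by (cases s) (auto simp: inv_solve_left m_assoc [symmetric] image_Un)
  moreover have "fst ` set ((x, s) # (x, \<not> s) # v) \<subseteq> carrier G"
    using assms by auto
  ultimately show ?thesis
    using assms by (subst (1 2) word_value_append) auto
qed

lemma generate_imp_word_value: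
  assumes "B \<subseteq> carrier G" "x \<in> generate G B"
  shows "\<exists>w. fst ` set w \<subseteq> B \<and> word_value G w = x"
  using assms(2)
proof (induction rule: generate.induct)
  case one
  show ?case by (intro exI [of _ "[]"]) simp
next
  case (incl h)
  then show ?case using assms(1) by (intro exI [of _ "[(h, True)]"]) auto
next
  case (inv h)
  then show ?case using assms(1) by (intro exI [of _ "[(h, False)]"]) auto
next
  case (eng h1 h2)
  then obtain w1 w2 where "fst ` set w1 \<subseteq> B" "word_value G w1 = h1"
    "fst ` set w2 \<subseteq> B" "word_value G w2 = h2"
    by blast
  then show ?case
    using assms(1) by (intro exI [of _ "w1 @ w2"]) (auto simp: word_value_append)
qed

end

lemma (in group_hom) hom_word_value:
  "fst ` set w \<subseteq> carrier G \<Longrightarrow> h (word_value G w) = word_value H (map (apfst h) w)"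
  by (induction w) auto

text \<open>A relation between basis elements holds in every group: a word of value \<open>\<one>\<close> is empty or
  contains a cancelling pair, and deleting the pair changes no value anywhere.\<close>

lemma free_basis_relation_universal:
  assumes F: "group F" and H: "group H" and B: "free_basis F B"
    and f: "f \<in> B \<rightarrow> carrier H"
    and "fst ` set w \<subseteq> B" "word_value F w = \<one>\<^bsub>F\<^esub>"
  shows "word_value H (map (apfst f) w) = \<one>\<^bsub>H\<^esub>"
  using assms(5,6)
proof (induction w rule: length_induct)
  case (1 w)
  have BF: "B \<subseteq> carrier F" using B by (simp add: free_basis_def)
  show ?case
  proof (cases "w = []")
    case False
    with 1 B have "\<not> reduced_word w" by (auto simp: free_basis_def)
    then obtain u x s v where w: "w = u @ (x, s) # (x, \<not> s) # v"
      using not_reduced_word_splits by blast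
    have fH: "f ` fst ` set w \<subseteq> carrier H" using f 1 by blast
    have "word_value F (u @ v) = \<one>\<^bsub>F\<^esub>"
      using group.word_value_cancel [OF F, of u x s v] 1(2,3) BF unfolding w by (metis subset_trans)
    then have "word_value H (map (apfst f) (u @ v)) = \<one>\<^bsub>H\<^esub>"
      using 1(1,2) w by (auto simp del: map_append simp: image_Un)
    moreover have "word_value H (map (apfst f) w) = word_value H (map (apfst f) (u @ v))"
      using group.word_value_cancel [OF H, of "map (apfst f) u" "f x" s "map (apfst f) v"] fH
      unfolding w by (simp add: image_Un image_image)
    ultimately show ?thesis by simp
  qed simp
qed

text \<open>The universal property of a free basis. The extension sends an element to the value, after
  substituting \<open>f\<close> for the letters, of any word that spells it; the choice of the word is
  immaterial because two words for one element differ by a relation.\<close>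

theorem free_basis_extend_hom:
  assumes F: "group F" and H: "group H" and B: "free_basis F B"
    and f: "f \<in> B \<rightarrow> carrier H"
  shows "\<exists>\<psi> \<in> hom F H. \<forall>b \<in> B. \<psi> b = f b"
proof -
  interpret F: group F by fact
  interpret H: group H by fact
  have BF: "B \<subseteq> carrier F" and gen: "generate F B = carrier F"
    using B by (auto simp: free_basis_def)
  let ?W = "\<lambda>w. fst ` set w \<subseteq> B"
  let ?vF = "word_value F" and ?vH = "\<lambda>w. word_value H (map (apfst f) w)"
  have WF: "fst ` set w \<subseteq> carrier F" and WH: "fst ` set (map (apfst f) w) \<subseteq> carrier H"
    if "?W w" for w
    using that BF f by (auto simp: image_subset_iff Pi_iff)
  have vH: "?vH w \<in> carrier H" if "?W w" for w
    using WH [OF that] by (rule H.word_value_closed)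
  have vH_append: "?vH (u @ v) = ?vH u \<otimes>\<^bsub>H\<^esub> ?vH v" if "?W u" "?W v" for u v
    using H.word_value_append WH that by (metis map_append)
  have well_defined: "?vH u = ?vH v" if "?W u" "?W v" "?vF u = ?vF v" for u v
  proof -
    have "?vF (u @ inverse_word v) = ?vF u \<otimes>\<^bsub>F\<^esub> inv\<^bsub>F\<^esub> (?vF v)"
      using that WF
      by (metis F.word_value_append F.word_value_inverse_word fst_set_inverse_word)
    then have "?vF (u @ inverse_word v) = \<one>\<^bsub>F\<^esub>"
      using that F.word_value_closed [OF WF] by simp
    then have "?vH (u @ inverse_word v) = \<one>\<^bsub>H\<^esub>"
      using that by (intro free_basis_relation_universal [OF F H B f]) (auto simp: image_Un)
    moreover have "?vH (u @ inverse_word v) = ?vH u \<otimes>\<^bsub>H\<^esub> inv\<^bsub>H\<^esub> (?vH v)"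
      using vH_append [of u "inverse_word v"] H.word_value_inverse_word [OF WH [OF that(2)]] that
      unfolding inverse_word_map_apfst fst_set_inverse_word by simp
    ultimately show ?thesis
      using H.inv_solve_right [of "\<one>\<^bsub>H\<^esub>" "?vH u" "?vH v"] vH [OF that(1)] vH [OF that(2)]
      by simp
  qed
  define word where "word x = (SOME w. ?W w \<and> ?vF w = x)" for x
  have word: "?W (word x)" "?vF (word x) = x" if "x \<in> carrier F" for x
    using someI_ex [OF F.generate_imp_word_value [OF BF, of x]] that gen
    unfolding word_def by auto
  show ?thesis
  proof (intro bexI [of _ "\<lambda>x. ?vH (word x)"] ballI)
    show "(\<lambda>x. ?vH (word x)) \<in> hom F H"
    proof (rule homI)
      fix x y assume xy: "x \<in> carrier F" "y \<in> carrier F"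
      have "?vF (word (x \<otimes>\<^bsub>F\<^esub> y)) = ?vF (word x @ word y)"
        using xy word F.word_value_append [OF WF WF] by simp
      then have "?vH (word (x \<otimes>\<^bsub>F\<^esub> y)) = ?vH (word x @ word y)"
        using word [OF xy(1)] word [OF xy(2)] word [OF F.m_closed [OF xy]]
        by (intro well_defined) (auto simp: image_Un)
      then show "?vH (word (x \<otimes>\<^bsub>F\<^esub> y)) = ?vH (word x) \<otimes>\<^bsub>H\<^esub> ?vH (word y)"
        using xy word vH_append by simp
    qed (use word vH in auto)
    fix b assume b: "b \<in> B"
    have "?vH (word b) = ?vH [(b, True)]"
      using b BF word by (intro well_defined) (auto simp: subset_iff)
    then show "?vH (word b) = f b"
      using funcset_mem [OF f b] by simp
  qed
qed

lemma hom_eq_on_generators: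
  assumes "group F" "group H" "\<psi> \<in> hom F H" "\<psi>' \<in> hom F H"
    and B: "B \<subseteq> carrier F" "generate F B = carrier F"
    and eq: "\<And>b. b \<in> B \<Longrightarrow> \<psi> b = \<psi>' b" and x: "x \<in> carrier F"
  shows "\<psi> x = \<psi>' x"
proof -
  interpret a: group_hom F H \<psi> using assms by (simp add: group_hom_def group_hom_axioms_def)
  interpret b: group_hom F H \<psi>' using assms by (simp add: group_hom_def group_hom_axioms_def)
  have "x \<in> generate F B" using B x by simp
  then show ?thesis
  proof (induction rule: generate.induct)
    case (eng h1 h2)
    then show ?case using a.H.generate_in_carrier B by (metis a.hom_mult b.hom_mult)
  qed (use B eq in auto)
qed

definition bool_group :: "bool monoid" where
  "bool_group = \<lparr>carrier = UNIV, mult = (\<noteq>), one = False\<rparr>"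

lemma group_bool_group: "group bool_group"
  by (rule groupI) (auto simp: bool_group_def)

text \<open>A homomorphism to the group of order two can be prescribed arbitrarily on the basis \<open>C\<close> and
  is determined by its values on the basis \<open>B\<close>, which gives \<open>2 ^ card T \<le> 2 ^ card B\<close>.\<close>

lemma free_basis_card_le:
  assumes F: "group F" and B: "free_basis F B" "finite B" and C: "free_basis F C"
    and T: "T \<subseteq> C" "finite T"
  shows "card T \<le> card B"
proof -
  have "\<exists>\<psi> \<in> hom F bool_group. \<forall>b \<in> C. \<psi> b = (b \<in> S)" for S
    using free_basis_extend_hom [OF F group_bool_group C] by (simp add: bool_group_def)
  then obtain \<psi> where hom: "\<And>S. \<psi> S \<in> hom F bool_group"
    and \<psi>: "\<And>S b. b \<in> C \<Longrightarrow> \<psi> S b = (b \<in> S)"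
    by metis
  have CF: "C \<subseteq> carrier F" and BF: "B \<subseteq> carrier F" "generate F B = carrier F"
    using B C by (auto simp: free_basis_def)
  have "inj_on (\<lambda>S. {b \<in> B. \<psi> S b}) (Pow T)"
  proof (rule inj_onI)
    fix S S' assume S: "S \<in> Pow T" "S' \<in> Pow T" and eq: "{b \<in> B. \<psi> S b} = {b \<in> B. \<psi> S' b}"
    have "\<psi> S x = \<psi> S' x" if "x \<in> carrier F" for x
      using hom_eq_on_generators [OF F group_bool_group hom hom BF _ that] eq by blast
    then have "x \<in> S \<longleftrightarrow> x \<in> S'" if "x \<in> C" for x
      using that CF \<psi> by blast
    then show "S = S'" using S T by blast
  qed
  then have "card (Pow T) \<le> card (Pow B)"
    by (rule card_inj_on_le) (use B in auto)
  then show ?thesis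
    using B T by (simp add: card_Pow)
qed

text \<open>A free basis through \<open>x\<close> has at most one further member \<open>y\<close>. If \<open>\<phi> x = \<one>\<close>, then \<open>\<phi> y\<close>
  generates \<open>G\<close>, so \<open>G\<close> is cyclic and hence abelian.\<close>

lemma primitive_not_in_kernel:
  assumes F: "free_group_of_rank F 2" and G: "group G" and \<phi>: "\<phi> \<in> epi F G"
    and nonabelian: "\<not> comm_group G" and x: "primitive_element F x"
  shows "x \<notin> kernel F G \<phi>"
proof
  assume ker: "x \<in> kernel F G \<phi>"
  obtain B where B: "free_basis F B" "finite B" "card B = 2" and grpF: "group F"
    using F by (auto simp: free_group_of_rank_def)
  obtain C where C: "free_basis F C" "x \<in> C"
    using x by (auto simp: primitive_element_def)
  interpret \<phi>: group_hom F G \<phi>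
    using \<phi> G grpF by (simp add: group_hom_def group_hom_axioms_def epi_def)
  have CF: "C \<subseteq> carrier F" "generate F C = carrier F"
    using C by (auto simp: free_basis_def)
  have "card {x, y, z} \<le> 2" if "y \<in> C" "z \<in> C" for y z
    using free_basis_card_le [OF grpF B(1,2) C(1), of "{x, y, z}"] B(3) C(2) that by auto
  then have two: "x = y \<or> x = z \<or> y = z" if "y \<in> C" "z \<in> C" for y z
    using that by (force simp: card_insert_if split: if_splits)
  have "\<phi> x = \<one>\<^bsub>G\<^esub>" using ker by (simp add: kernel_def)
  then obtain g where g: "g \<in> carrier G" "\<phi> ` C \<subseteq> {\<one>\<^bsub>G\<^esub>, g}"
  proof (cases "C = {x}")
    case True
    with that [of "\<one>\<^bsub>G\<^esub>"] \<open>\<phi> x = _\<close> show thesis by auto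
  next
    case False
    then obtain y where "y \<in> C" "y \<noteq> x" using C by blast
    then have "\<phi> ` C \<subseteq> {\<one>\<^bsub>G\<^esub>, \<phi> y}" using \<open>\<phi> x = _\<close> two by blast
    then show thesis using that [of "\<phi> y"] \<open>y \<in> C\<close> CF by auto
  qed
  have "\<phi> ` C \<subseteq> generate G {g}"
    using g(2) generate.one [of G "{g}"] generate.incl [of g "{g}" G] by auto
  then have "generate G (\<phi> ` C) \<subseteq> generate G {g}"
    using g(1) by (intro \<phi>.H.generate_subgroup_incl \<phi>.H.generate_is_subgroup) auto
  moreover have "generate G (\<phi> ` C) = carrier G"
    using \<phi>.generate_img [of C] CF \<phi> by (auto simp: epi_def)
  ultimately have gen: "carrier G \<subseteq> range (\<lambda>k::int. g [^]\<^bsub>G\<^esub> k)"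
    using \<phi>.H.generate_pow [OF g(1)] by auto
  have "comm_group G"
  proof (rule \<phi>.H.group_comm_groupI)
    fix a b assume "a \<in> carrier G" "b \<in> carrier G"
    then obtain k l :: int where "a = g [^]\<^bsub>G\<^esub> k" "b = g [^]\<^bsub>G\<^esub> l"
      using gen by blast
    then show "a \<otimes>\<^bsub>G\<^esub> b = b \<otimes>\<^bsub>G\<^esub> a"
      using g by (simp add: \<phi>.H.int_pow_mult [symmetric] add.commute)
  qed
  with nonabelian show False by simp
qed


lemma reduced_word_map_apfst:
  assumes "inj_on f (fst ` set w)" "reduced_word w"
  shows "reduced_word (map (apfst f) w)"
  using assms(2) unfolding reduced_word_def successively_map
  by (rule successively_mono) (use assms(1) in \<open>auto simp: inj_on_def\<close>)

lemma free_basis_iso: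
  assumes G: "group G" and H: "group H" and \<theta>: "\<theta> \<in> iso G H" and B: "free_basis G B"
  shows "free_basis H (\<theta> ` B)"
proof -
  interpret \<theta>: group_hom G H \<theta>
    using G H \<theta> by (simp add: group_hom_def group_hom_axioms_def iso_def)
  have bij: "bij_betw \<theta> (carrier G) (carrier H)" using \<theta> by (simp add: iso_def)
  have BG: "B \<subseteq> carrier G" "generate G B = carrier G" using B by (auto simp: free_basis_def)
  show ?thesis
    unfolding free_basis_def
  proof (intro conjI allI impI)
    show "\<theta> ` B \<subseteq> carrier H" using BG by auto
    show "generate H (\<theta> ` B) = carrier H"
      using \<theta>.generate_img [OF BG(1)] BG(2) bij by (simp add: bij_betw_def)
    fix w assume "w \<noteq> [] \<and> fst ` set w \<subseteq> \<theta> ` B \<and> reduced_word w"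
    then have w: "w \<noteq> []" "fst ` set w \<subseteq> \<theta> ` B" "reduced_word w" by auto
    define v where "v = map (apfst (inv_into B \<theta>)) w"
    have "map (apfst \<theta>) v = map id w"
      unfolding v_def map_map using w(2)
      by (intro map_cong refl) (auto simp: apfst_def map_prod_def f_inv_into_f subset_iff split: prod.splits)
    then have w_eq: "w = map (apfst \<theta>) v" by simp
    have vB: "fst ` set v \<subseteq> B"
      using w(2) unfolding v_def fst_set_map_apfst by (blast intro: inv_into_into)
    have "reduced_word v"
      unfolding v_def using w by (intro reduced_word_map_apfst inj_on_inv_into) auto
    then have "word_value G v \<noteq> \<one>\<^bsub>G\<^esub>"
      using B vB w(1) by (auto simp: free_basis_def v_def)
    moreover have "word_value G v \<in> carrier G"
      using vB BG by (intro group.word_value_closed [OF G]) auto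
    ultimately have "\<theta> (word_value G v) \<noteq> \<theta> \<one>\<^bsub>G\<^esub>"
      using bij by (auto simp: bij_betw_def inj_on_def)
    then show "word_value H w \<noteq> \<one>\<^bsub>H\<^esub>"
      using \<theta>.hom_word_value [of v] vB BG by (simp add: w_eq)
  qed
qed

lemma primitive_element_iso:
  assumes "group G" "group H" "\<theta> \<in> iso G H" "primitive_element G x"
  shows "primitive_element H (\<theta> x)"
  using assms free_basis_iso unfolding primitive_element_def by blast

section \<open>The quaternion group\<close>

text \<open>The numbers \<open>0, 1, 2, 3\<close> stand for the unit quaternions \<open>1, i, j, k\<close>, and adding \<open>4\<close>
  changes the sign.\<close>

definition quaternion_mult :: "nat \<Rightarrow> nat \<Rightarrow> nat" where
  "quaternion_mult g h =
    [[0, 1, 2, 3, 4, 5, 6, 7],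
     [1, 4, 3, 6, 5, 0, 7, 2],
     [2, 7, 4, 1, 6, 3, 0, 5],
     [3, 2, 5, 4, 7, 6, 1, 0],
     [4, 5, 6, 7, 0, 1, 2, 3],
     [5, 0, 7, 2, 1, 4, 3, 6],
     [6, 3, 0, 5, 2, 7, 4, 1],
     [7, 6, 1, 0, 3, 2, 5, 4]] ! g ! h"

definition quaternion_group :: "nat monoid" where
  "quaternion_group = \<lparr>carrier = {..<8}, mult = quaternion_mult, one = 0\<rparr>"

lemma less_8_cases: "g < 8 \<Longrightarrow> g \<in> {0, 1, 2, 3, 4, 5, 6, 7 :: nat}"
  by auto

lemma less_4_cases: "i < 4 \<Longrightarrow> i \<in> {0, 1, 2, 3 :: nat}"
  by auto

lemma quaternion_mult_closed: "g < 8 \<Longrightarrow> h < 8 \<Longrightarrow> quaternion_mult g h < 8"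
proof -
  have "\<forall>g \<in> set [0..<8]. \<forall>h \<in> set [0..<8]. quaternion_mult g h < 8"
    by code_simp
  then show "g < 8 \<Longrightarrow> h < 8 \<Longrightarrow> quaternion_mult g h < 8" by simp
qed

lemma quaternion_mult_assoc:
  assumes "g < 8" "h < 8" "l < 8"
  shows "quaternion_mult (quaternion_mult g h) l = quaternion_mult g (quaternion_mult h l)"
proof -
  have "\<forall>g \<in> set [0..<8]. \<forall>h \<in> set [0..<8]. \<forall>l \<in> set [0..<8].
      quaternion_mult (quaternion_mult g h) l = quaternion_mult g (quaternion_mult h l)"
    by code_simp
  with assms show ?thesis by simp
qed

lemma quaternion_mult_one_inv:
  assumes "g < 8"
  shows "quaternion_mult 0 g = g" "\<exists>h<8. quaternion_mult h g = 0"
proof -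
  have "\<forall>g \<in> set [0..<8]. quaternion_mult 0 g = g \<and> (\<exists>h \<in> set [0..<8]. quaternion_mult h g = 0)"
    by code_simp
  moreover have "g \<in> set [0..<8]" using assms by simp
  ultimately have "quaternion_mult 0 g = g \<and> (\<exists>h \<in> set [0..<8]. quaternion_mult h g = 0)"
    by (rule bspec)
  then show "quaternion_mult 0 g = g" "\<exists>h<8. quaternion_mult h g = 0"
    by auto
qed

lemma group_quaternion_group: "group quaternion_group"
  by (rule groupI)
    (use quaternion_mult_one_inv in
      \<open>auto simp: quaternion_group_def quaternion_mult_closed quaternion_mult_assoc\<close>)

lemma quaternion_group_nonabelian: "\<not> comm_group quaternion_group"
proof
  assume "comm_group quaternion_group"
  then have "quaternion_mult 1 2 = quaternion_mult 2 1"
    using comm_monoid.m_comm [of quaternion_group 1 2]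
    by (simp add: comm_group_def quaternion_group_def)
  then show False by (simp add: quaternion_mult_def)
qed

lemma quaternion_subgroup_full:
  assumes H: "subgroup H quaternion_group" and "1 \<in> H" "2 \<in> H"
  shows "H = {..<8}"
proof -
  have mult: "quaternion_mult g h \<in> H" if "g \<in> H" "h \<in> H" for g h
    using subgroup.m_closed [OF H that] by (simp add: quaternion_group_def)
  have "4 \<in> H" using mult [of 1 1] assms by (simp add: quaternion_mult_def)
  moreover have "3 \<in> H" using mult [of 1 2] assms by (simp add: quaternion_mult_def)
  moreover have "0 \<in> H" "5 \<in> H" "6 \<in> H" "7 \<in> H"
    using mult [of 4 4] mult [of 4 1] mult [of 4 2] mult [of 4 3] calculation assms
    by (simp_all add: quaternion_mult_def)
  ultimately have "{0, 1, 2, 3, 4, 5, 6, 7} \<subseteq> H" using assms by simp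
  moreover have "{..<8} = {0, 1, 2, 3, 4, 5, 6, 7 :: nat}" by auto
  ultimately have "{..<8} \<subseteq> H" by simp
  then show ?thesis
    using subgroup.subset [OF H] by (auto simp: quaternion_group_def)
qed

definition quaternion_inv :: "nat \<Rightarrow> nat" where
  "quaternion_inv g = [0, 5, 6, 7, 4, 1, 2, 3] ! g"

text \<open>Left translation on the odd functions on the quaternion group, those with
  \<open>X (- h) = - X h\<close>. Such a function is \<open>odd_extension x\<close> for its restriction \<open>x\<close> to
  \<open>{1, i, j, k}\<close>; so the action law is associativity, and freeness comes from \<open>-1\<close>.\<close>

definition odd_extension :: "(nat \<Rightarrow> real) \<Rightarrow> nat \<Rightarrow> real" where
  "odd_extension x h = (if h < 4 then x h else - x (h - 4))"

definition quaternion_action :: "nat \<Rightarrow> (nat \<Rightarrow> real) \<Rightarrow> nat \<Rightarrow> real" where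
  "quaternion_action g x i =
    (if i < 4 then odd_extension x (quaternion_mult (quaternion_inv g) i) else 0)"

lemma quaternion_inv_closed: "g < 8 \<Longrightarrow> quaternion_inv g < 8"
proof -
  have "\<forall>g \<in> set [0..<8]. quaternion_inv g < 8" by code_simp
  then show "g < 8 \<Longrightarrow> quaternion_inv g < 8" by simp
qed

lemma quaternion_inv_mult:
  assumes "g < 8" "h < 8"
  shows "quaternion_inv (quaternion_mult g h) = quaternion_mult (quaternion_inv h) (quaternion_inv g)"
proof -
  have "\<forall>g \<in> set [0..<8]. \<forall>h \<in> set [0..<8].
      quaternion_inv (quaternion_mult g h) = quaternion_mult (quaternion_inv h) (quaternion_inv g)"
    by code_simp
  with assms show ?thesis by simp
qed

lemma quaternion_mult_minus:
  assumes "g < 8" "i < 4"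
  shows "quaternion_mult g (i + 4) = (quaternion_mult g i + 4) mod 8"
proof -
  have "\<forall>g \<in> set [0..<8]. \<forall>i \<in> set [0..<4].
      quaternion_mult g (i + 4) = (quaternion_mult g i + 4) mod 8"
    by code_simp
  with assms show ?thesis by simp
qed

lemma quaternion_mult_square:
  assumes "g < 8" "g \<noteq> 0" "g \<noteq> 4"
  shows "quaternion_mult g g = 4"
proof -
  have "\<forall>g \<in> set [0..<8]. g \<noteq> 0 \<longrightarrow> g \<noteq> 4 \<longrightarrow> quaternion_mult g g = 4"
    by code_simp
  with assms show ?thesis by simp
qed

lemma odd_extension_minus:
  assumes "h < 8"
  shows "odd_extension x ((h + 4) mod 8) = - odd_extension x h"
proof (cases "h < 4")
  case False
  then have "(h + 4) mod 8 = h - 4" "h - 4 < 4" using assms by (simp_all add: mod_if)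
  then show ?thesis using False assms by (simp add: odd_extension_def)
qed (simp add: odd_extension_def)

lemma odd_extension_action:
  assumes "g < 8" "h < 8"
  shows "odd_extension (quaternion_action g x) h = odd_extension x (quaternion_mult (quaternion_inv g) h)"
proof (cases "h < 4")
  case True
  then show ?thesis by (simp add: odd_extension_def [of "quaternion_action g x"] quaternion_action_def)
next
  case False
  let ?k = "quaternion_mult (quaternion_inv g) (h - 4)"
  have "?k < 8" using assms by (intro quaternion_mult_closed quaternion_inv_closed) auto
  moreover have "h - 4 < 4" using False assms(2) by simp
  moreover have "quaternion_mult (quaternion_inv g) h = (?k + 4) mod 8"
    using quaternion_mult_minus [OF quaternion_inv_closed [OF assms(1)], of "h - 4"] False assms(2)
    by simp
  ultimately show ?thesis
    using False assms(2) odd_extension_minus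
    by (simp add: odd_extension_def [of "quaternion_action g x"] quaternion_action_def)
qed

lemma quaternion_action_mult:
  assumes "g < 8" "h < 8"
  shows "quaternion_action (quaternion_mult g h) x = quaternion_action g (quaternion_action h x)"
proof
  fix i
  show "quaternion_action (quaternion_mult g h) x i = quaternion_action g (quaternion_action h x) i"
  proof (cases "i < 4")
    case True
    then show ?thesis
      using assms odd_extension_action [OF assms(2), of "quaternion_mult (quaternion_inv g) i" x]
      by (simp add: quaternion_action_def [of g] quaternion_action_def [of "quaternion_mult g h"]
          quaternion_inv_mult quaternion_mult_assoc quaternion_mult_closed quaternion_inv_closed)
  qed (simp add: quaternion_action_def)
qed

text \<open>Left translation permutes the four coordinates up to sign.\<close>

lemma quaternion_action_norm:
  assumes "g < 8"
  shows "(\<Sum>i\<le>3. (quaternion_action g x i)\<^sup>2) = (\<Sum>i\<le>3. (x i)\<^sup>2)"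
proof -
  have sum4: "(\<Sum>i\<le>3. y i) = y 0 + y 1 + y 2 + y 3" for y :: "nat \<Rightarrow> real"
    by (simp add: numeral_3_eq_3 numeral_2_eq_2)
  show ?thesis
    using less_8_cases [OF assms] unfolding sum4
    by (elim insertE emptyE; simp add: quaternion_action_def odd_extension_def
        quaternion_mult_def quaternion_inv_def)
qed

lemma quaternion_action_linear:
  "quaternion_action g (\<lambda>i. a * x i + b * y i) =
    (\<lambda>i. a * quaternion_action g x i + b * quaternion_action g y i)"
  by (auto simp: quaternion_action_def odd_extension_def)

text \<open>Every non-identity element has \<open>-1\<close> (the number \<open>4\<close>) among its powers, and \<open>-1\<close> acts as
  multiplication by \<open>-1\<close>, which fixes only the zero vector.\<close>

lemma quaternion_action_free:
  assumes g: "g < 8" "g \<noteq> 0" and fixed: "quaternion_action g x = x"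
  shows "x i = 0"
proof (cases "i < 4")
  case True
  have "quaternion_action 4 x = x"
    using quaternion_action_mult [OF g(1) g(1), of x] quaternion_mult_square [OF g] fixed
    by (cases "g = 4") auto
  then have "x i = quaternion_action 4 x i" by simp
  also have "\<dots> = odd_extension x (quaternion_mult 4 i)"
    using True by (simp add: quaternion_action_def quaternion_inv_def)
  \<comment> \<open>Multiplying by \<open>4\<close> sends \<open>i < 4\<close> to \<open>i + 4\<close>, its negative.\<close>
  also have "\<dots> = - x i"
    using less_4_cases [OF True]
    by (elim insertE emptyE; simp add: odd_extension_def quaternion_mult_def)
  finally show ?thesis by simp
next
  case False
  then have "quaternion_action g x i = 0" by (simp add: quaternion_action_def)
  then show ?thesis using fixed by simp
qed

lemma quaternion_group_acts_freely: "acts_freely_linearly_on_sphere quaternion_group 3"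
proof -
  let ?E = "topspace (Euclidean_space 4)"
  let ?\<rho> = "\<lambda>g. restrict (quaternion_action g) ?E"
  have E: "quaternion_action g x \<in> ?E" for g x
    by (simp add: topspace_Euclidean_space quaternion_action_def)
  have one: "quaternion_action 0 x = x" if "x \<in> ?E" for x
  proof
    fix i
    show "quaternion_action 0 x i = x i"
    proof (cases "i < 4")
      case True
      then show ?thesis
        using less_4_cases [OF True]
        by (elim insertE emptyE; simp add: quaternion_action_def odd_extension_def
            quaternion_mult_def quaternion_inv_def)
    next
      case False
      then show ?thesis using that by (simp add: topspace_Euclidean_space quaternion_action_def)
    qed
  qed
  have Bij: "?\<rho> g \<in> Bij ?E" if g: "g < 8" for g
  proof -
    obtain h where h: "h < 8" "quaternion_mult h g = 0"
      using quaternion_mult_one_inv(2) [OF g] by blast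
    then have gh: "quaternion_mult g h = 0"
      using group.inv_comm [OF group_quaternion_group, of h g] g h
      by (simp add: quaternion_group_def)
    have "bij_betw (?\<rho> g) ?E ?E"
    proof (rule bij_betw_byWitness [where f' = "quaternion_action h"])
      show "\<forall>x \<in> ?E. quaternion_action h (?\<rho> g x) = x"
        using quaternion_action_mult [OF h(1) g, symmetric] h one by simp
      show "\<forall>x \<in> ?E. ?\<rho> g (quaternion_action h x) = x"
        using quaternion_action_mult [OF g h(1), symmetric] gh one E by simp
    qed (use E in auto)
    then show ?thesis by (simp add: Bij_def)
  qed
  have "group_hom quaternion_group (BijGroup ?E) ?\<rho>"
    unfolding group_hom_def group_hom_axioms_def
  proof (intro conjI group_quaternion_group group_BijGroup homI)
    fix g h assume "g \<in> carrier quaternion_group" "h \<in> carrier quaternion_group"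
    then have gh: "g < 8" "h < 8" by (simp_all add: quaternion_group_def)
    then have "?\<rho> (quaternion_mult g h) = compose ?E (?\<rho> g) (?\<rho> h)"
      by (auto simp: compose_def fun_eq_iff E quaternion_action_mult)
    then show "?\<rho> (g \<otimes>\<^bsub>quaternion_group\<^esub> h) = ?\<rho> g \<otimes>\<^bsub>BijGroup ?E\<^esub> ?\<rho> h"
      using Bij gh by (simp add: quaternion_group_def BijGroup_def)
  qed (use Bij in \<open>auto simp: quaternion_group_def BijGroup_def\<close>)
  then have rep: "linear_representation quaternion_group (Suc 3) ?\<rho>"
    unfolding linear_representation_def group_action_def
    using quaternion_action_linear
    by (auto simp: quaternion_group_def topspace_Euclidean_space)
  have sphere: "topspace (nsphere 3) = {x \<in> ?E. (\<Sum>i\<le>3. (x i)\<^sup>2) = 1}"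
    by (auto simp: nsphere_def)
  show ?thesis
    unfolding acts_freely_linearly_on_sphere_def
  proof (intro exI [of _ ?\<rho>] conjI ballI impI)
    show "linear_representation quaternion_group (Suc 3) ?\<rho>" by (rule rep)
    fix g assume "g \<in> carrier quaternion_group"
    then have g: "g < 8" by (simp add: quaternion_group_def)
    then show "?\<rho> g ` topspace (nsphere 3) \<subseteq> topspace (nsphere 3)"
      using E quaternion_action_norm by (auto simp: sphere)
    fix x assume "g \<noteq> \<one>\<^bsub>quaternion_group\<^esub>" and x: "x \<in> topspace (nsphere 3)"
    show "?\<rho> g x \<noteq> x"
    proof
      assume "?\<rho> g x = x"
      then have "x i = 0" for i
        using quaternion_action_free [OF g] x \<open>g \<noteq> _\<close>
        by (simp add: sphere quaternion_group_def)
      with x show False by (simp add: sphere)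
    qed
  qed
qed

lemma exists_quaternion_quotient:
  assumes "free_group_of_rank F 2"
  shows "\<exists>\<phi>. \<phi> \<in> epi F quaternion_group"
proof -
  obtain B where B: "free_basis F B" "card B = 2" and F: "group F"
    using assms by (auto simp: free_group_of_rank_def)
  obtain a b where ab: "B = {a, b}" "a \<noteq> b" using B(2) by (auto simp: card_2_iff)
  obtain \<phi> where \<phi>: "\<phi> \<in> hom F quaternion_group" "\<forall>x \<in> B. \<phi> x = (if x = a then 1 else 2)"
    using free_basis_extend_hom [OF F group_quaternion_group B(1), of "\<lambda>x. if x = a then 1 else 2"]
    by (auto simp: quaternion_group_def)
  then interpret \<phi>: group_hom F quaternion_group \<phi>
    using F group_quaternion_group by (simp add: group_hom_def group_hom_axioms_def)
  have "a \<in> carrier F" "b \<in> carrier F" using B ab by (auto simp: free_basis_def)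
  then have "1 \<in> \<phi> ` carrier F" "2 \<in> \<phi> ` carrier F"
    using \<phi>(2) ab by (metis image_eqI insertCI)+
  then have "\<phi> ` carrier F = {..<8}"
    using quaternion_subgroup_full \<phi>.img_is_subgroup by blast
  then show ?thesis using \<phi>(1) by (auto simp: epi_def quaternion_group_def)
qed

section \<open>Crossed homomorphisms\<close>

text \<open>A homomorphism \<open>x \<mapsto> (c x, \<phi> x)\<close> into this group is the same as a homomorphism \<open>\<phi>\<close> together
  with a crossed homomorphism \<open>c\<close>; this turns the universal property of a free basis into one for
  crossed homomorphisms.\<close>

definition semidirect_product ::
    "(nat \<Rightarrow> real) set \<Rightarrow> ('g, 'm) monoid_scheme \<Rightarrow> ('g \<Rightarrow> (nat \<Rightarrow> real) \<Rightarrow> (nat \<Rightarrow> real)) \<Rightarrow>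
     ((nat \<Rightarrow> real) \<times> 'g) monoid" where
  "semidirect_product E G \<rho> =
    \<lparr>carrier = E \<times> carrier G,
     mult = (\<lambda>(v, g) (w, h). (\<lambda>i. v i + \<rho> g w i, g \<otimes>\<^bsub>G\<^esub> h)),
     one = (\<lambda>i. 0, \<one>\<^bsub>G\<^esub>)\<rparr>"

locale free_sphere_representation = group G for G :: "('g, 'm) monoid_scheme" (structure) +
  fixes N :: nat and \<rho> :: "'g \<Rightarrow> (nat \<Rightarrow> real) \<Rightarrow> (nat \<Rightarrow> real)"
  assumes representation: "linear_representation G (Suc N) \<rho>"
    and fixed_point_free: "\<And>g x. g \<in> carrier G \<Longrightarrow> g \<noteq> \<one> \<Longrightarrow> x \<in> topspace (nsphere N) \<Longrightarrow> \<rho> g x \<noteq> x"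
begin

abbreviation E where "E \<equiv> topspace (Euclidean_space (Suc N))"

lemma E_zero: "(\<lambda>i. 0) \<in> E"
  by (simp add: topspace_Euclidean_space)

lemma E_add: "x \<in> E \<Longrightarrow> y \<in> E \<Longrightarrow> (\<lambda>i. x i + y i) \<in> E"
  by (simp add: topspace_Euclidean_space)

lemma E_sum: "(\<And>s. s \<in> S \<Longrightarrow> f s \<in> E) \<Longrightarrow> (\<lambda>i. \<Sum>s\<in>S. f s i) \<in> E"
  by (simp add: topspace_Euclidean_space)

sublocale \<rho>: group_hom G "BijGroup E" \<rho>
  using representation by (simp add: linear_representation_def group_action_def)

lemma \<rho>_closed: "g \<in> carrier G \<Longrightarrow> x \<in> E \<Longrightarrow> \<rho> g x \<in> E"
  using \<rho>.hom_closed [of g] by (auto simp: BijGroup_def dest: Bij_imp_funcset)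

lemma \<rho>_mult:
  assumes "g \<in> carrier G" "h \<in> carrier G" "x \<in> E"
  shows "\<rho> (g \<otimes> h) x = \<rho> g (\<rho> h x)"
proof -
  have "\<rho> g \<in> Bij E" "\<rho> h \<in> Bij E"
    using assms \<rho>.hom_closed by (auto simp: BijGroup_def)
  then show ?thesis
    using \<rho>.hom_mult [of g h] assms by (simp add: BijGroup_def compose_eq)
qed

lemma \<rho>_one: "x \<in> E \<Longrightarrow> \<rho> \<one> x = x"
  using \<rho>.hom_one by (simp add: BijGroup_def)

lemma \<rho>_linear:
  "g \<in> carrier G \<Longrightarrow> x \<in> E \<Longrightarrow> y \<in> E \<Longrightarrow>
    \<rho> g (\<lambda>i. a * x i + b * y i) = (\<lambda>i. a * \<rho> g x i + b * \<rho> g y i)"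
  using representation by (simp add: linear_representation_def)

lemma \<rho>_add:
  "g \<in> carrier G \<Longrightarrow> x \<in> E \<Longrightarrow> y \<in> E \<Longrightarrow> \<rho> g (\<lambda>i. x i + y i) = (\<lambda>i. \<rho> g x i + \<rho> g y i)"
  using \<rho>_linear [of g x y 1 1] by simp

lemma \<rho>_scale:
  "g \<in> carrier G \<Longrightarrow> x \<in> E \<Longrightarrow> \<rho> g (\<lambda>i. a * x i) = (\<lambda>i. a * \<rho> g x i)"
  using \<rho>_linear [of g x x a 0] by simp

lemma \<rho>_zero: "g \<in> carrier G \<Longrightarrow> \<rho> g (\<lambda>i. 0) = (\<lambda>i. 0)"
  using \<rho>_scale [of g "\<lambda>i. 0" 0] E_zero by simp

lemma \<rho>_sum:
  assumes "g \<in> carrier G" "\<And>s. s \<in> S \<Longrightarrow> f s \<in> E"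
  shows "\<rho> g (\<lambda>i. \<Sum>s\<in>S. f s i) = (\<lambda>i. \<Sum>s\<in>S. \<rho> g (f s) i)"
  using assms(2)
proof (induction S rule: infinite_finite_induct)
  case (insert s S)
  then have "\<rho> g (\<lambda>i. f s i + (\<Sum>s\<in>S. f s i)) = (\<lambda>i. \<rho> g (f s) i + \<rho> g (\<lambda>i. \<Sum>s\<in>S. f s i) i)"
    using assms(1) E_sum [of S f] by (intro \<rho>_add) auto
  with insert show ?case by simp
qed (use \<rho>_zero assms(1) in auto)

text \<open>Every nonzero vector is a multiple of a unit vector, so by linearity only the zero vector is
  fixed by a non-identity element.\<close>

lemma fixed_imp_zero:
  assumes g: "g \<in> carrier G" "g \<noteq> \<one>" and x: "x \<in> E" and fixed: "\<rho> g x = x"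
  shows "x = (\<lambda>i. 0)"
proof (rule ccontr)
  assume "x \<noteq> (\<lambda>i. 0)"
  then obtain j where "x j \<noteq> 0" by auto
  then have "j \<le> N" using x not_less_eq_eq unfolding topspace_Euclidean_space by blast
  define r where "r = sqrt (\<Sum>i\<le>N. (x i)\<^sup>2)"
  have "(\<Sum>i\<le>N. (x i)\<^sup>2) > 0"
    using \<open>x j \<noteq> 0\<close> \<open>j \<le> N\<close> by (intro sum_pos2 [of _ j]) auto
  then have r: "r > 0" "(\<Sum>i\<le>N. (x i)\<^sup>2) = r\<^sup>2"
    by (simp_all add: r_def)
  let ?u = "\<lambda>i. (1 / r) * x i"
  have "(\<Sum>i\<le>N. (?u i)\<^sup>2) = 1"
    using r by (simp add: power_mult_distrib power_divide flip: sum_divide_distrib)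
  then have "?u \<in> topspace (nsphere N)"
    using x by (simp add: nsphere_def topspace_Euclidean_space)
  moreover have "\<rho> g ?u = ?u"
    using \<rho>_scale [OF g(1) x, of "1 / r"] fixed by simp
  ultimately show False
    using fixed_point_free g by blast
qed

lemma group_semidirect_product: "group (semidirect_product E G \<rho>)"
proof (rule groupI)
  fix x assume "x \<in> carrier (semidirect_product E G \<rho>)"
  then obtain v g where x: "x = (v, g)" "v \<in> E" "g \<in> carrier G"
    by (auto simp: semidirect_product_def)
  have "\<rho> (inv g) v \<in> E" using x by (intro \<rho>_closed) auto
  then have "(\<lambda>i. - \<rho> (inv g) v i) \<in> E" by (simp add: topspace_Euclidean_space)
  with x have "((\<lambda>i. - \<rho> (inv g) v i), inv g) \<in> carrier (semidirect_product E G \<rho>)"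
    by (simp add: semidirect_product_def)
  moreover have "((\<lambda>i. - \<rho> (inv g) v i), inv g) \<otimes>\<^bsub>semidirect_product E G \<rho>\<^esub> x =
      \<one>\<^bsub>semidirect_product E G \<rho>\<^esub>"
    using x by (simp add: semidirect_product_def)
  ultimately show "\<exists>y\<in>carrier (semidirect_product E G \<rho>).
      y \<otimes>\<^bsub>semidirect_product E G \<rho>\<^esub> x = \<one>\<^bsub>semidirect_product E G \<rho>\<^esub>"
    by blast
qed (auto simp del: \<rho>.hom_mult \<rho>.hom_one simp: semidirect_product_def E_zero E_add \<rho>_closed \<rho>_add \<rho>_mult \<rho>_one \<rho>_zero m_assoc add.assoc)

end

locale crossed_homomorphism = free_sphere_representation G N \<rho> + F: group F
  for G :: "('g, 'm) monoid_scheme" (structure) and N \<rho> and F :: "('f, 'n) monoid_scheme" +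
  fixes \<phi> :: "'f \<Rightarrow> 'g" and c :: "'f \<Rightarrow> nat \<Rightarrow> real"
  assumes \<phi>: "\<phi> \<in> hom F G"
    and c_closed: "x \<in> carrier F \<Longrightarrow> c x \<in> E"
    and c_mult: "x \<in> carrier F \<Longrightarrow> y \<in> carrier F \<Longrightarrow>
      c (x \<otimes>\<^bsub>F\<^esub> y) = (\<lambda>i. c x i + \<rho> (\<phi> x) (c y) i)"
begin

sublocale \<phi>: group_hom F G \<phi>
  using \<phi> by unfold_locales

text \<open>The kernel of \<open>\<phi>\<close> acts trivially on \<open>E\<close>, so there \<open>c\<close> is additive.\<close>

lemma c_kernel_mult:
  assumes "x \<in> kernel F G \<phi>" "y \<in> carrier F"
  shows "c (x \<otimes>\<^bsub>F\<^esub> y) = (\<lambda>i. c x i + c y i)"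
  using assms c_mult c_closed \<rho>_one by (simp add: kernel_def)

text \<open>If \<open>x\<^sup>k\<close> lies in the kernel, then \<open>x\<^sup>k\<^sup>+\<^sup>1 = x\<^sup>k x = x x\<^sup>k\<close> makes \<open>c (x\<^sup>k)\<close> a fixed vector of
  \<open>\<phi> x\<close>.\<close>

lemma c_power_zero:
  fixes k :: nat
  assumes x: "x \<in> carrier F" "\<phi> x \<noteq> \<one>" and ker: "x [^]\<^bsub>F\<^esub> k \<in> kernel F G \<phi>"
  shows "c (x [^]\<^bsub>F\<^esub> k) = (\<lambda>i. 0)"
proof (rule fixed_imp_zero [of "\<phi> x"])
  let ?y = "x [^]\<^bsub>F\<^esub> k"
  have "?y \<otimes>\<^bsub>F\<^esub> x = x \<otimes>\<^bsub>F\<^esub> ?y"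
    using F.nat_pow_Suc2 [OF x(1), of k] by simp
  then have "(\<lambda>i. c ?y i + c x i) = (\<lambda>i. c x i + \<rho> (\<phi> x) (c ?y) i)"
    using c_kernel_mult [OF ker x(1)] c_mult [of x ?y] x by simp
  then show "\<rho> (\<phi> x) (c ?y) = c ?y"
    by (auto simp: fun_eq_iff)
qed (use x c_closed in auto)

text \<open>A crossed homomorphism that vanishes on the kernel factors through the finite group \<open>G\<close> and
  is therefore principal, by averaging. If it also vanishes at an element that acts without
  nonzero fixed vectors, then it is zero.\<close>

lemma vanishing_on_kernel_imp_zero:
  assumes surj: "\<phi> ` carrier F = carrier G" and fin: "finite (carrier G)"
    and ker: "\<And>k. k \<in> kernel F G \<phi> \<Longrightarrow> c k = (\<lambda>i. 0)"
    and a: "a \<in> carrier F" "\<phi> a \<noteq> \<one>" "c a = (\<lambda>i. 0)" and x: "x \<in> carrier F"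
  shows "c x = (\<lambda>i. 0)"
proof -
  have factors: "c y = c z" if "y \<in> carrier F" "z \<in> carrier F" "\<phi> y = \<phi> z" for y z
  proof -
    let ?k = "y \<otimes>\<^bsub>F\<^esub> inv\<^bsub>F\<^esub> z"
    have "?k \<in> kernel F G \<phi>" using that by (simp add: kernel_def)
    moreover have "y = ?k \<otimes>\<^bsub>F\<^esub> z" using that by (simp add: F.m_assoc)
    ultimately show ?thesis
      using c_kernel_mult [of ?k z] that ker by simp
  qed
  define lift where "lift g = (SOME y. y \<in> carrier F \<and> \<phi> y = g)" for g
  have lift: "lift g \<in> carrier F" "\<phi> (lift g) = g" if "g \<in> carrier G" for g
  proof -
    have "\<exists>y. y \<in> carrier F \<and> \<phi> y = g" using that surj by (metis imageE)
    from someI_ex [OF this] show "lift g \<in> carrier F" "\<phi> (lift g) = g"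
      by (simp_all add: lift_def)
  qed
  define v where "v = (\<lambda>i. \<Sum>g\<in>carrier G. c (lift g) i)"
  have v: "v \<in> E" unfolding v_def using lift c_closed by (intro E_sum) auto
  \<comment> \<open>The substitution \<open>g \<mapsto> \<phi> y \<otimes> g\<close> in the sum that defines \<open>v\<close>.\<close>
  have principal: "\<rho> (\<phi> y) v i = v i - card (carrier G) * c y i" if y: "y \<in> carrier F" for y i
  proof -
    have "\<rho> (\<phi> y) v = (\<lambda>i. \<Sum>g\<in>carrier G. \<rho> (\<phi> y) (c (lift g)) i)"
      unfolding v_def using y lift c_closed by (intro \<rho>_sum) auto
    then have "\<rho> (\<phi> y) v i = (\<Sum>g\<in>carrier G. \<rho> (\<phi> y) (c (lift g)) i)" by simp
    also have "\<dots> = (\<Sum>g\<in>carrier G. c (lift (\<phi> y \<otimes> g)) i - c y i)"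
    proof (rule sum.cong [OF refl])
      fix g assume g: "g \<in> carrier G"
      have "c (lift (\<phi> y \<otimes> g)) = c (y \<otimes>\<^bsub>F\<^esub> lift g)"
        using g y lift by (intro factors) auto
      then show "\<rho> (\<phi> y) (c (lift g)) i = c (lift (\<phi> y \<otimes> g)) i - c y i"
        using c_mult [OF y, of "lift g"] lift g by simp
    qed
    also have "\<dots> = (\<Sum>g\<in>carrier G. c (lift (\<phi> y \<otimes> g)) i) - card (carrier G) * c y i"
      by (simp add: sum_subtractf)
    also have "(\<Sum>g\<in>carrier G. c (lift (\<phi> y \<otimes> g)) i) = v i"
      unfolding v_def
      using sum.reindex_bij_betw [of "\<lambda>g. \<phi> y \<otimes> g" "carrier G" "carrier G" "\<lambda>g. c (lift g) i"]
        inj_on_multc surj_const_mult inj_on_cmult y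
      by (simp add: bij_betw_def)
    finally show ?thesis .
  qed
  have "\<rho> (\<phi> a) v = v"
    using principal [OF a(1)] a(3) by (simp add: fun_eq_iff)
  then have "v = (\<lambda>i. 0)"
    using a v by (intro fixed_imp_zero [of "\<phi> a"]) auto
  then have "card (carrier G) * c x i = 0" for i
    using principal [OF x, of i] \<rho>_zero [of "\<phi> x"] x by simp
  moreover have "card (carrier G) \<noteq> 0"
    using fin one_closed by auto
  ultimately show ?thesis by auto
qed

end

text \<open>The crossed homomorphism is the first component of the homomorphism to the semidirect product
  that sends \<open>b\<close> to \<open>(u b, \<phi> b)\<close>; its second component agrees with \<open>\<phi>\<close> on \<open>B\<close>, hence everywhere.\<close>

lemma (in free_sphere_representation) exists_crossed_homomorphism:
  fixes F :: "('f, 'n) monoid_scheme"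
  assumes F: "group F" and B: "free_basis F B" and \<phi>: "\<phi> \<in> hom F G" and u: "u \<in> B \<rightarrow> E"
  shows "\<exists>c. crossed_homomorphism G N \<rho> F \<phi> c \<and> (\<forall>b \<in> B. c b = u b)"
proof -
  let ?P = "semidirect_product E G \<rho>"
  have BF: "B \<subseteq> carrier F" "generate F B = carrier F"
    using B by (auto simp: free_basis_def)
  have "(\<lambda>b. (u b, \<phi> b)) \<in> B \<rightarrow> carrier ?P"
    using u \<phi> BF(1) by (auto simp: semidirect_product_def hom_def)
  from free_basis_extend_hom [OF F group_semidirect_product B this]
  obtain \<psi> where \<psi>: "\<psi> \<in> hom F ?P" "\<forall>b \<in> B. \<psi> b = (u b, \<phi> b)"
    by (rule bexE)
  have closed: "\<psi> x \<in> E \<times> carrier G" if "x \<in> carrier F" for x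
    using hom_in_carrier [OF \<psi>(1) that] by (simp add: semidirect_product_def)
  have mult: "\<psi> (x \<otimes>\<^bsub>F\<^esub> y) = (\<lambda>i. fst (\<psi> x) i + \<rho> (snd (\<psi> x)) (fst (\<psi> y)) i, snd (\<psi> x) \<otimes> snd (\<psi> y))"
    if "x \<in> carrier F" "y \<in> carrier F" for x y
    using hom_mult [OF \<psi>(1) that] by (simp add: semidirect_product_def case_prod_unfold)
  have snd_hom: "(\<lambda>x. snd (\<psi> x)) \<in> hom F G"
    using closed mult by (intro homI) (auto simp: mem_Times_iff)
  have snd: "snd (\<psi> x) = \<phi> x" if "x \<in> carrier F" for x
    by (rule hom_eq_on_generators [OF F group_axioms snd_hom \<phi> BF _ that]) (simp add: \<psi>(2))
  have "crossed_homomorphism G N \<rho> F \<phi> (\<lambda>x. fst (\<psi> x))"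
    using closed mult snd F \<phi> free_sphere_representation_axioms
    by (auto simp: crossed_homomorphism_def crossed_homomorphism_axioms_def mem_Times_iff)
  then show ?thesis
    using \<psi>(2) by (intro exI [of _ "\<lambda>x. fst (\<psi> x)"]) simp
qed

section \<open>Homotopy classes of paths\<close>

text \<open>Homotopies that only reparametrize a path \<open>p\<close> are images under \<open>p\<close> of homotopies in the
  simply connected interval. This gives the unit and inverse laws in an arbitrary topological
  space.\<close>

lemma homotopic_paths_compose_interval:
  fixes p :: "real \<Rightarrow> 'a::topological_space"
  assumes "path p" "path_image p \<subseteq> S"
    and "path r" "path_image r \<subseteq> {0..1}" "path s" "path_image s \<subseteq> {0..1}"
    and "pathstart r = pathstart s" "pathfinish r = pathfinish s"
  shows "homotopic_paths S (p \<circ> r) (p \<circ> s)"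
proof (rule homotopic_paths_continuous_image)
  have "simply_connected {0..1::real}"
    by (simp add: convex_imp_simply_connected)
  then show "homotopic_paths {0..1} r s"
    using assms by (simp add: simply_connected_eq_homotopic_paths)
qed (use assms in \<open>auto simp: path_def path_image_def\<close>)

lemma path_const [simp]: "path (\<lambda>t. x)"
  by (simp add: path_def)

lemma pathstart_const [simp]: "pathstart (\<lambda>t. x) = x"
  by (simp add: pathstart_def)

lemma pathfinish_const [simp]: "pathfinish (\<lambda>t. x) = x"
  by (simp add: pathfinish_def)

lemma path_image_const [simp]: "path_image (\<lambda>t. x) = {x}"
  by (auto simp: path_image_def)

lemma homotopic_paths_const_join:
  fixes p :: "real \<Rightarrow> 'a::topological_space"
  assumes "path p" "path_image p \<subseteq> S"
  shows "homotopic_paths S ((\<lambda>t. pathstart p) +++ p) p"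
proof -
  have "homotopic_paths S (p \<circ> ((\<lambda>t. 0) +++ linepath 0 1)) (p \<circ> linepath 0 1)"
    using assms by (intro homotopic_paths_compose_interval)
      (auto simp: path_image_join closed_segment_eq_real_ivl)
  then show ?thesis
    unfolding path_compose_join by (simp add: o_def linepath_def pathstart_def)
qed

lemma homotopic_paths_join_reversepath:
  fixes p :: "real \<Rightarrow> 'a::topological_space"
  assumes "path p" "path_image p \<subseteq> S"
  shows "homotopic_paths S (p +++ reversepath p) (\<lambda>t. pathstart p)"
proof -
  have "homotopic_paths S (p \<circ> (linepath 0 1 +++ linepath 1 0)) (p \<circ> (\<lambda>t. 0))"
    using assms by (intro homotopic_paths_compose_interval)
      (auto simp: path_image_join closed_segment_eq_real_ivl)
  then show ?thesis
    unfolding path_compose_join by (simp add: o_def linepath_def pathstart_def reversepath_def)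
qed

lemma homotopic_paths_reversepath_join:
  fixes p :: "real \<Rightarrow> 'a::topological_space"
  assumes "path p" "path_image p \<subseteq> S"
  shows "homotopic_paths S (reversepath p +++ p) (\<lambda>t. pathfinish p)"
  using homotopic_paths_join_reversepath [of "reversepath p" S] assms by simp

lemma homotopic_paths_cancel_middle:
  fixes p :: "real \<Rightarrow> 'a::topological_space"
  assumes p: "path p" "path_image p \<subseteq> S" and q: "path q" "path_image q \<subseteq> S"
    and r: "path r" "path_image r \<subseteq> S"
    and ends: "pathfinish p = pathfinish q" "pathfinish q = pathstart r"
  shows "homotopic_paths S ((p +++ reversepath q) +++ (q +++ r)) (p +++ r)"
proof -
  have "homotopic_paths S ((p +++ reversepath q) +++ (q +++ r)) (p +++ (reversepath q +++ (q +++ r)))"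
    using assms by (intro homotopic_paths_sym [OF homotopic_paths_assoc])
      (auto simp: path_image_join)
  moreover have "homotopic_paths S (reversepath q +++ (q +++ r)) ((reversepath q +++ q) +++ r)"
    using assms by (intro homotopic_paths_assoc) auto
  moreover have "homotopic_paths S ((reversepath q +++ q) +++ r) ((\<lambda>t. pathstart r) +++ r)"
    using assms homotopic_paths_reversepath_join [of q S]
    by (intro homotopic_paths_join) auto
  moreover have "homotopic_paths S ((\<lambda>t. pathstart r) +++ r) r"
    using r by (rule homotopic_paths_const_join)
  ultimately have inner: "homotopic_paths S (reversepath q +++ (q +++ r)) r"
    and outer: "homotopic_paths S ((p +++ reversepath q) +++ (q +++ r)) (p +++ (reversepath q +++ (q +++ r)))"
    by (meson homotopic_paths_trans)+
  have "homotopic_paths S (p +++ (reversepath q +++ (q +++ r))) (p +++ r)"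
    using assms inner by (intro homotopic_paths_join) auto
  with outer show ?thesis by (rule homotopic_paths_trans)
qed


section \<open>The fundamental group\<close>

lemma loops_at_join: "\<gamma> \<in> loops_at X x \<Longrightarrow> \<delta> \<in> loops_at X x \<Longrightarrow> \<gamma> +++ \<delta> \<in> loops_at X x"
  by (auto simp: loops_at_def path_image_join)

lemma loops_at_reversepath: "\<gamma> \<in> loops_at X x \<Longrightarrow> reversepath \<gamma> \<in> loops_at X x"
  by (auto simp: loops_at_def)

lemma loops_at_const: "x \<in> X \<Longrightarrow> (\<lambda>t. x) \<in> loops_at X x"
  by (auto simp: loops_at_def)

lemma loop_power_in_loops_at:
  assumes "\<gamma> \<in> loops_at X x"
  shows "loop_power \<gamma> k \<in> loops_at X x"
proof (induction k)
  case 0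
  have "x \<in> X" using assms pathstart_in_path_image [of \<gamma>] by (auto simp: loops_at_def)
  then show ?case using assms loops_at_const by (auto simp: loops_at_def)
qed (use assms loops_at_join in auto)

lemma homotopy_class_eq_iff:
  assumes "path \<gamma>" "path_image \<gamma> \<subseteq> X"
  shows "homotopy_class X \<gamma> = homotopy_class X \<delta> \<longleftrightarrow> homotopic_paths X \<gamma> \<delta>"
proof
  assume "homotopy_class X \<gamma> = homotopy_class X \<delta>"
  moreover have "\<gamma> \<in> homotopy_class X \<gamma>" using assms by (simp add: homotopy_class_def)
  ultimately show "homotopic_paths X \<gamma> \<delta>"
    by (simp add: homotopy_class_def homotopic_paths_sym)
next
  assume "homotopic_paths X \<gamma> \<delta>"
  then show "homotopy_class X \<gamma> = homotopy_class X \<delta>"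
    unfolding homotopy_class_def by (blast intro: homotopic_paths_sym homotopic_paths_trans)
qed

lemma homotopy_class_in_carrier:
  "\<gamma> \<in> loops_at X x \<Longrightarrow> homotopy_class X \<gamma> \<in> carrier (fundamental_group X x)"
  by (simp add: fundamental_group_def)

lemma homotopy_class_eqI:
  "homotopic_paths X \<gamma> \<delta> \<Longrightarrow> homotopy_class X \<gamma> = homotopy_class X \<delta>"
  using homotopy_class_eq_iff homotopic_paths_imp_path homotopic_paths_imp_subset by metis

lemma fundamental_group_mult:
  assumes "\<gamma> \<in> loops_at X x" "\<delta> \<in> loops_at X x"
  shows "homotopy_class X \<gamma> \<otimes>\<^bsub>fundamental_group X x\<^esub> homotopy_class X \<delta> =
    homotopy_class X (\<gamma> +++ \<delta>)"
proof -
  have "homotopy_class X (\<gamma>' +++ \<delta>') = homotopy_class X (\<gamma> +++ \<delta>)"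
    if "\<gamma>' \<in> homotopy_class X \<gamma>" "\<delta>' \<in> homotopy_class X \<delta>" for \<gamma>' \<delta>'
    using that assms
    by (intro homotopy_class_eqI [OF homotopic_paths_sym] homotopic_paths_join)
      (auto simp: homotopy_class_def loops_at_def)
  then have "(\<Union>\<gamma>'\<in>homotopy_class X \<gamma>. \<Union>\<delta>'\<in>homotopy_class X \<delta>. homotopy_class X (\<gamma>' +++ \<delta>')) =
      (\<Union>\<gamma>'\<in>homotopy_class X \<gamma>. \<Union>\<delta>'\<in>homotopy_class X \<delta>. homotopy_class X (\<gamma> +++ \<delta>))"
    by (intro SUP_cong refl)
  moreover have "\<gamma> \<in> homotopy_class X \<gamma>" "\<delta> \<in> homotopy_class X \<delta>"
    using assms by (simp_all add: homotopy_class_def loops_at_def)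
  then have "homotopy_class X \<gamma> \<noteq> {}" "homotopy_class X \<delta> \<noteq> {}"
    by blast+
  ultimately show ?thesis
    by (simp add: fundamental_group_def)
qed

lemma homotopy_class_join_reversepath:
  assumes "\<gamma> \<in> loops_at X x"
  shows "homotopy_class X (\<gamma> +++ reversepath \<gamma>) = \<one>\<^bsub>fundamental_group X x\<^esub>"
  using homotopy_class_eqI [OF homotopic_paths_join_reversepath, of \<gamma> X] assms
  by (auto simp: loops_at_def fundamental_group_def)

lemma group_fundamental_group:
  assumes "x \<in> X"
  shows "group (fundamental_group X x)"
proof (rule groupI)
  let ?G = "fundamental_group X x"
  have one: "\<one>\<^bsub>?G\<^esub> = homotopy_class X (\<lambda>t. x)" by (simp add: fundamental_group_def)
  show "\<one>\<^bsub>?G\<^esub> \<in> carrier ?G"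
    using assms by (simp add: one homotopy_class_in_carrier loops_at_const)
  fix A assume "A \<in> carrier ?G"
  then obtain \<alpha> where \<alpha>: "\<alpha> \<in> loops_at X x" "A = homotopy_class X \<alpha>"
    by (auto simp: fundamental_group_def)
  show "\<one>\<^bsub>?G\<^esub> \<otimes>\<^bsub>?G\<^esub> A = A"
    using homotopy_class_eqI [OF homotopic_paths_const_join, of \<alpha> X] \<alpha> assms
    by (simp add: one fundamental_group_mult loops_at_const) (auto simp: loops_at_def)
  show "\<exists>B\<in>carrier ?G. B \<otimes>\<^bsub>?G\<^esub> A = \<one>\<^bsub>?G\<^esub>"
  proof (intro bexI)
    show "homotopy_class X (reversepath \<alpha>) \<otimes>\<^bsub>?G\<^esub> A = \<one>\<^bsub>?G\<^esub>"
      using homotopy_class_join_reversepath [OF loops_at_reversepath [OF \<alpha>(1)]] \<alpha>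
      by (simp add: fundamental_group_mult loops_at_reversepath)
  qed (use \<alpha> in \<open>simp add: homotopy_class_in_carrier loops_at_reversepath\<close>)
  fix B assume "B \<in> carrier ?G"
  then obtain \<beta> where \<beta>: "\<beta> \<in> loops_at X x" "B = homotopy_class X \<beta>"
    by (auto simp: fundamental_group_def)
  show "A \<otimes>\<^bsub>?G\<^esub> B \<in> carrier ?G"
    using \<alpha> \<beta> by (simp add: fundamental_group_mult homotopy_class_in_carrier loops_at_join)
  fix C assume "C \<in> carrier ?G"
  then obtain \<gamma> where \<gamma>: "\<gamma> \<in> loops_at X x" "C = homotopy_class X \<gamma>"
    by (auto simp: fundamental_group_def)
  have "homotopic_paths X (\<alpha> +++ (\<beta> +++ \<gamma>)) ((\<alpha> +++ \<beta>) +++ \<gamma>)"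
    using \<alpha> \<beta> \<gamma> by (intro homotopic_paths_assoc) (auto simp: loops_at_def)
  then have assoc: "homotopy_class X ((\<alpha> +++ \<beta>) +++ \<gamma>) = homotopy_class X (\<alpha> +++ (\<beta> +++ \<gamma>))"
    by (rule homotopy_class_eqI [OF homotopic_paths_sym])
  show "A \<otimes>\<^bsub>?G\<^esub> B \<otimes>\<^bsub>?G\<^esub> C = A \<otimes>\<^bsub>?G\<^esub> (B \<otimes>\<^bsub>?G\<^esub> C)"
    unfolding \<alpha>(2) \<beta>(2) \<gamma>(2) fundamental_group_mult [OF \<alpha>(1) \<beta>(1)]
      fundamental_group_mult [OF \<beta>(1) \<gamma>(1)]
      fundamental_group_mult [OF \<alpha>(1) loops_at_join [OF \<beta>(1) \<gamma>(1)]]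
      fundamental_group_mult [OF loops_at_join [OF \<alpha>(1) \<beta>(1)] \<gamma>(1)]
    by (rule assoc)
qed

lemma homotopy_class_reversepath:
  assumes "\<gamma> \<in> loops_at X x" "x \<in> X"
  shows "homotopy_class X (reversepath \<gamma>) = inv\<^bsub>fundamental_group X x\<^esub> (homotopy_class X \<gamma>)"
proof -
  interpret group "fundamental_group X x" by (rule group_fundamental_group [OF assms(2)])
  have "homotopy_class X (reversepath \<gamma>) \<otimes>\<^bsub>fundamental_group X x\<^esub> homotopy_class X \<gamma> =
      \<one>\<^bsub>fundamental_group X x\<^esub>"
    using homotopy_class_join_reversepath [OF loops_at_reversepath [OF assms(1)]] assms
    by (simp add: fundamental_group_mult loops_at_reversepath)
  then show ?thesis
    by (rule inv_equality [OF _ homotopy_class_in_carrier [OF assms(1)]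
          homotopy_class_in_carrier [OF loops_at_reversepath [OF assms(1)]], symmetric])
qed

lemma homotopy_class_loop_power:
  fixes k :: nat
  assumes "\<gamma> \<in> loops_at X x" "x \<in> X"
  shows "homotopy_class X (loop_power \<gamma> k) = homotopy_class X \<gamma> [^]\<^bsub>fundamental_group X x\<^esub> k"
proof -
  interpret group "fundamental_group X x" by (rule group_fundamental_group [OF assms(2)])
  have one: "homotopy_class X (\<lambda>t. x) = \<one>\<^bsub>fundamental_group X x\<^esub>"
    by (simp add: fundamental_group_def)
  have start: "pathstart \<gamma> = x"
    using assms(1) by (simp add: loops_at_def)
  show ?thesis
  proof (induction k)
    case 0
    show ?case by (simp only: loop_power.simps nat_pow_0 start one)
  next
    case (Suc k)
    show ?case
      by (simp only: loop_power.simps nat_pow_Suc2 [OF homotopy_class_in_carrier [OF assms(1)]]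
          Suc [symmetric] fundamental_group_mult [OF assms(1) loop_power_in_loops_at [OF assms(1)]])
  qed
qed

section \<open>From the fundamental group to singular homology\<close>

text \<open>The parameter is the barycentric coordinate of the second vertex.\<close>

definition edge_path :: "((nat \<Rightarrow> real) \<Rightarrow> 'a) \<Rightarrow> real \<Rightarrow> 'a" where
  "edge_path \<sigma> t = \<sigma> (\<lambda>i. if i = 0 then 1 - t else if i = 1 then t else 0)"

lemma edge_in_standard_simplex:
  "t \<in> {0..1} \<Longrightarrow> (\<lambda>i. if i = 0 then 1 - t else if i = 1 then t else 0) \<in> standard_simplex 1"
  by (auto simp: standard_simplex_def)

lemma edge_path_singular_simplex:
  assumes "singular_simplex 1 (top_of_set Y) \<sigma>"
  shows "path (edge_path \<sigma>)" "path_image (edge_path \<sigma>) \<subseteq> Y"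
proof -
  have "continuous_map (top_of_set {0..1::real}) (subtopology (powertop_real UNIV) (standard_simplex 1))
      (\<lambda>t i. if i = 0 then 1 - t else if i = 1 then t else 0)"
    unfolding continuous_map_in_subtopology continuous_map_componentwise_UNIV
  proof (intro conjI allI)
    fix i :: nat
    show "continuous_map (top_of_set {0..1}) euclideanreal
        (\<lambda>t. if i = 0 then 1 - t else if i = 1 then t else 0)"
      by (cases "i = 0"; cases "i = 1") (auto intro!: continuous_intros)
  qed (use edge_in_standard_simplex in auto)
  from continuous_map_compose [OF this, of "top_of_set Y" \<sigma>]
  have "continuous_map (top_of_set {0..1}) (top_of_set Y) (edge_path \<sigma>)"
    using assms by (simp add: singular_simplex_def edge_path_def [abs_def] o_def)
  then show "path (edge_path \<sigma>)" "path_image (edge_path \<sigma>) \<subseteq> Y"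
    by (auto simp: path_def path_image_def)
qed

text \<open>Across a triangle, which is convex, the path along two edges can be pushed to the third
  edge.\<close>

lemma edge_path_triangle:
  assumes f: "singular_simplex 2 (top_of_set Y) f"
  shows "homotopic_paths Y (edge_path (singular_face 2 2 f) +++ edge_path (singular_face 2 0 f))
      (edge_path (singular_face 2 1 f))"
    and "pathfinish (edge_path (singular_face 2 2 f)) = pathstart (edge_path (singular_face 2 0 f))"
proof -
  define T where "T = {(s, t). 0 \<le> s \<and> 0 \<le> t \<and> s + t \<le> (1::real)}"
  define e where "e = (\<lambda>(s, t) i::nat. if i = 0 then 1 - s - t else if i = 1 then s
    else if i = 2 then t else (0::real))"
  have "convex T"
  proof (rule convexI)
    fix x y :: "real \<times> real" and u v :: real
    assume *: "x \<in> T" "y \<in> T" "0 \<le> u" "0 \<le> v" "u + v = 1"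
    have "u * (fst x + snd x) + v * (fst y + snd y) \<le> u * 1 + v * 1"
      using * by (intro add_mono mult_left_mono) (auto simp: T_def)
    then show "u *\<^sub>R x + v *\<^sub>R y \<in> T"
      using * by (cases x; cases y) (auto simp: T_def algebra_simps)
  qed
  then have sc: "simply_connected T" by (rule convex_imp_simply_connected)
  have eT: "e z \<in> standard_simplex 2" if "z \<in> T" for z
    using that by (cases z) (auto simp: T_def e_def standard_simplex_def numeral_2_eq_2)
  have "continuous_map (top_of_set T) (subtopology (powertop_real UNIV) (standard_simplex 2)) e"
    unfolding continuous_map_in_subtopology continuous_map_componentwise_UNIV
  proof (intro conjI allI)
    fix i
    show "continuous_map (top_of_set T) euclideanreal (\<lambda>z. e z i)"
      by (cases "i = 0"; cases "i = 1"; cases "i = 2")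
        (auto simp: e_def case_prod_unfold intro!: continuous_intros)
  qed (use eT in auto)
  then have "continuous_map (top_of_set T) (top_of_set Y) (f \<circ> e)"
    using f by (intro continuous_map_compose) (auto simp: singular_simplex_def)
  then have fe: "continuous_on T (f \<circ> e)" "f \<circ> e \<in> T \<rightarrow> Y"
    by auto
  let ?p = "linepath (0, 0) (1, 0) :: real \<Rightarrow> real \<times> real"
  let ?q = "linepath (1, 0) (0, 1) :: real \<Rightarrow> real \<times> real"
  let ?r = "linepath (0, 0) (0, 1) :: real \<Rightarrow> real \<times> real"
  have "(0, 0) \<in> T" "(1, 0) \<in> T" "(0, 1) \<in> T"
    by (simp_all add: T_def)
  then have "closed_segment (0, 0) (1, 0) \<subseteq> T" "closed_segment (1, 0) (0, 1) \<subseteq> T"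
    "closed_segment (0, 0) (0, 1) \<subseteq> T"
    using \<open>convex T\<close> by (simp_all add: closed_segment_subset)
  then have "homotopic_paths T (?p +++ ?q) ?r"
    using sc by (auto simp: simply_connected_eq_homotopic_paths path_image_join)
  then have hom: "homotopic_paths Y ((f \<circ> e) \<circ> (?p +++ ?q)) ((f \<circ> e) \<circ> ?r)"
    using fe by (rule homotopic_paths_continuous_image)
  have face: "edge_path (singular_face 2 k f) t =
      f (simplical_face k (\<lambda>i. if i = 0 then 1 - t else if i = 1 then t else 0))"
    if "t \<in> {0..1}" for t k
    using edge_in_standard_simplex [OF that]
    by (simp add: edge_path_def singular_face_def o_def)
  have 2: "edge_path (singular_face 2 2 f) t = (f \<circ> e) (?p t)"
    and 0: "edge_path (singular_face 2 0 f) t = (f \<circ> e) (?q t)"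
    and 1: "edge_path (singular_face 2 1 f) t = (f \<circ> e) (?r t)" if "t \<in> {0..1}" for t
    using that
    by (auto simp: face e_def linepath_def simplical_face_def fun_eq_iff intro!: arg_cong [where f = f])
  have "homotopic_paths Y ((f \<circ> e) \<circ> (?p +++ ?q))
      (edge_path (singular_face 2 2 f) +++ edge_path (singular_face 2 0 f))"
    using homotopic_paths_imp_path [OF hom] homotopic_paths_imp_subset [OF hom] 2 0
    by (intro homotopic_paths_eq) (auto simp: joinpaths_def)
  moreover have "homotopic_paths Y ((f \<circ> e) \<circ> ?r) (edge_path (singular_face 2 1 f))"
    using homotopic_paths_imp_path [OF hom] homotopic_paths_imp_subset [OF hom] 1
    by (intro homotopic_paths_eq) auto
  ultimately show "homotopic_paths Y (edge_path (singular_face 2 2 f) +++ edge_path (singular_face 2 0 f))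
      (edge_path (singular_face 2 1 f))"
    using hom homotopic_paths_sym homotopic_paths_trans by meson
  show "pathfinish (edge_path (singular_face 2 2 f)) = pathstart (edge_path (singular_face 2 0 f))"
    by (simp add: pathfinish_def pathstart_def 2 0 linepath_def)
qed


text \<open>A homomorphism \<open>h\<close> from the fundamental group at \<open>y0\<close> to \<open>\<complex>\<close>, given on loops rather than on
  their classes, extends to singular 1-chains: close up every edge by chosen paths from \<open>y0\<close> to
  its ends and apply \<open>h\<close>. The extension is additive under joining paths, hence kills boundaries of
  triangles and is defined on homology. This is the part of the Hurewicz theorem that is needed to
  detect homology classes.\<close>

locale loop_functional =
  fixes Y :: "'b::topological_space set" and y0 :: 'b and h :: "(real \<Rightarrow> 'b) \<Rightarrow> complex"
  assumes h_homotopic: "\<And>\<alpha> \<beta>. \<alpha> \<in> loops_at Y y0 \<Longrightarrow> homotopic_paths Y \<alpha> \<beta> \<Longrightarrow> h \<alpha> = h \<beta>"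
    and h_join: "\<And>\<alpha> \<beta>. \<alpha> \<in> loops_at Y y0 \<Longrightarrow> \<beta> \<in> loops_at Y y0 \<Longrightarrow> h (\<alpha> +++ \<beta>) = h \<alpha> + h \<beta>"
begin

definition tether :: "'b \<Rightarrow> real \<Rightarrow> 'b" where
  "tether y = (SOME q. path q \<and> path_image q \<subseteq> Y \<and> pathstart q = y0 \<and> pathfinish q = y)"

lemma tether:
  assumes "path_component Y y0 y"
  shows "path (tether y)" "path_image (tether y) \<subseteq> Y"
    "pathstart (tether y) = y0" "pathfinish (tether y) = y"
proof -
  have "\<exists>q. path q \<and> path_image q \<subseteq> Y \<and> pathstart q = y0 \<and> pathfinish q = y"
    using assms by (simp add: path_component_def)
  from someI_ex [OF this] show "path (tether y)" "path_image (tether y) \<subseteq> Y"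
    "pathstart (tether y) = y0" "pathfinish (tether y) = y"
    by (simp_all add: tether_def)
qed

text \<open>The value \<open>0\<close> away from the path component of \<open>y0\<close> keeps the functional additive on paths,
  as both halves of a joined path lie in one path component.\<close>

definition path_value :: "(real \<Rightarrow> 'b) \<Rightarrow> complex" where
  "path_value \<alpha> = (if path_component Y y0 (pathstart \<alpha>)
     then h (tether (pathstart \<alpha>) +++ (\<alpha> +++ reversepath (tether (pathfinish \<alpha>)))) else 0)"

lemma path_component_pathfinish:
  assumes "path \<alpha>" "path_image \<alpha> \<subseteq> Y" "path_component Y y0 (pathstart \<alpha>)"
  shows "path_component Y y0 (pathfinish \<alpha>)"
  using assms path_component_trans unfolding path_component_def by metis

lemma tethered_loop:
  assumes "path \<alpha>" "path_image \<alpha> \<subseteq> Y" "path_component Y y0 (pathstart \<alpha>)"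
  shows "tether (pathstart \<alpha>) +++ (\<alpha> +++ reversepath (tether (pathfinish \<alpha>))) \<in> loops_at Y y0"
  using assms tether [OF assms(3)] tether [OF path_component_pathfinish [OF assms]]
  by (auto simp: loops_at_def path_image_join)

lemma path_value_homotopic:
  assumes hom: "homotopic_paths Y \<alpha> \<beta>"
  shows "path_value \<alpha> = path_value \<beta>"
proof (cases "path_component Y y0 (pathstart \<alpha>)")
  case True
  have \<alpha>: "path \<alpha>" "path_image \<alpha> \<subseteq> Y"
    using hom homotopic_paths_imp_path homotopic_paths_imp_subset by blast+
  have ends: "pathstart \<beta> = pathstart \<alpha>" "pathfinish \<beta> = pathfinish \<alpha>"
    using homotopic_paths_imp_pathstart [OF hom] homotopic_paths_imp_pathfinish [OF hom] by simp_all
  have "homotopic_paths Y (tether (pathstart \<alpha>) +++ (\<alpha> +++ reversepath (tether (pathfinish \<alpha>))))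
      (tether (pathstart \<alpha>) +++ (\<beta> +++ reversepath (tether (pathfinish \<alpha>))))"
    using hom tether [OF True] tether [OF path_component_pathfinish [OF \<alpha> True]]
    by (intro homotopic_paths_join) auto
  then show ?thesis
    using True ends h_homotopic [OF tethered_loop [OF \<alpha> True]] by (simp add: path_value_def)
next
  case False
  then show ?thesis
    using homotopic_paths_imp_pathstart [OF hom] by (simp add: path_value_def)
qed

text \<open>The path to the common endpoint is traversed back and forth and cancels.\<close>

lemma path_value_join:
  assumes \<alpha>: "path \<alpha>" "path_image \<alpha> \<subseteq> Y" and \<beta>: "path \<beta>" "path_image \<beta> \<subseteq> Y"
    and ends: "pathfinish \<alpha> = pathstart \<beta>"
  shows "path_value (\<alpha> +++ \<beta>) = path_value \<alpha> + path_value \<beta>"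
proof (cases "path_component Y y0 (pathstart \<alpha>)")
  case True
  let ?q = "tether (pathstart \<alpha>)" and ?r = "tether (pathfinish \<alpha>)" and ?s = "tether (pathfinish \<beta>)"
  have True\<beta>: "path_component Y y0 (pathstart \<beta>)"
    using path_component_pathfinish [OF \<alpha> True] ends by simp
  note q = tether [OF True] and r = tether [OF path_component_pathfinish [OF \<alpha> True]]
    and s = tether [OF path_component_pathfinish [OF \<beta> True\<beta>]]
  have \<alpha>loop: "?q +++ (\<alpha> +++ reversepath ?r) \<in> loops_at Y y0"
    using tethered_loop [OF \<alpha> True] .
  have \<beta>loop: "?r +++ (\<beta> +++ reversepath ?s) \<in> loops_at Y y0"
    using tethered_loop [OF \<beta> True\<beta>] ends by simp
  have 1: "homotopic_paths Y ((?q +++ (\<alpha> +++ reversepath ?r)) +++ (?r +++ (\<beta> +++ reversepath ?s)))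
      (?q +++ ((\<alpha> +++ reversepath ?r) +++ (?r +++ (\<beta> +++ reversepath ?s))))"
    using \<alpha> \<beta> ends q r s
    by (intro homotopic_paths_sym [OF homotopic_paths_assoc]) (auto simp: path_image_join)
  have 2: "homotopic_paths Y ((\<alpha> +++ reversepath ?r) +++ (?r +++ (\<beta> +++ reversepath ?s)))
      (\<alpha> +++ (\<beta> +++ reversepath ?s))"
    using \<alpha> \<beta> ends r s by (intro homotopic_paths_cancel_middle) (auto simp: path_image_join)
  have 3: "homotopic_paths Y (\<alpha> +++ (\<beta> +++ reversepath ?s)) ((\<alpha> +++ \<beta>) +++ reversepath ?s)"
    using \<alpha> \<beta> ends s by (intro homotopic_paths_assoc) auto
  have "homotopic_paths Y (?q +++ ((\<alpha> +++ reversepath ?r) +++ (?r +++ (\<beta> +++ reversepath ?s))))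
      (?q +++ ((\<alpha> +++ \<beta>) +++ reversepath ?s))"
    using q by (intro homotopic_paths_join homotopic_paths_trans [OF 2 3]) auto
  from homotopic_paths_trans [OF 1 this]
  have "h ((?q +++ (\<alpha> +++ reversepath ?r)) +++ (?r +++ (\<beta> +++ reversepath ?s))) =
      h (?q +++ ((\<alpha> +++ \<beta>) +++ reversepath ?s))"
    using h_homotopic loops_at_join [OF \<alpha>loop \<beta>loop] by blast
  then show ?thesis
    using h_join [OF \<alpha>loop \<beta>loop] True True\<beta> ends by (simp add: path_value_def)
next
  case False
  have "path_component Y (pathstart \<beta>) (pathstart \<alpha>)"
    using \<alpha> ends path_component_sym unfolding path_component_def by metis
  then have "\<not> path_component Y y0 (pathstart \<beta>)"
    using False path_component_trans by blast
  with False show ?thesis by (simp add: path_value_def)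
qed

text \<open>The values of \<open>h\<close> lie in an abelian group.\<close>

lemma h_conjugate:
  assumes q: "q \<in> loops_at Y y0" and \<alpha>: "\<alpha> \<in> loops_at Y y0"
  shows "h (q +++ (\<alpha> +++ reversepath q)) = h \<alpha>"
proof -
  have y0: "y0 \<in> Y" using q pathstart_in_path_image [of q] by (auto simp: loops_at_def)
  have c: "(\<lambda>t. y0) \<in> loops_at Y y0" using y0 by (rule loops_at_const)
  have "homotopic_paths Y ((\<lambda>t. y0) +++ (\<lambda>t. y0)) (\<lambda>t. y0)"
    using homotopic_paths_const_join [of "\<lambda>t. y0" Y] y0 by simp
  then have "h (\<lambda>t. y0) + h (\<lambda>t. y0) = h (\<lambda>t. y0)"
    using h_homotopic [OF loops_at_join [OF c c]] h_join [OF c c] by simp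
  then have "h (\<lambda>t. y0) = 0" by simp
  moreover have "homotopic_paths Y (q +++ reversepath q) (\<lambda>t. y0)"
    using homotopic_paths_join_reversepath [of q Y] q by (auto simp: loops_at_def)
  ultimately have "h q + h (reversepath q) = 0"
    using h_homotopic [OF loops_at_join [OF q loops_at_reversepath [OF q]]]
      h_join [OF q loops_at_reversepath [OF q]] by simp
  then show ?thesis
    using q \<alpha> by (simp add: h_join loops_at_join loops_at_reversepath algebra_simps add_eq_0_iff)
qed

lemma path_value_loop:
  assumes "\<alpha> \<in> loops_at Y y0"
  shows "path_value \<alpha> = h \<alpha>"
proof -
  have y0: "y0 \<in> Y" using assms pathstart_in_path_image [of \<alpha>] by (auto simp: loops_at_def)
  then have pc: "path_component Y y0 y0" by (rule path_component_refl)
  have "tether y0 \<in> loops_at Y y0" using tether [OF pc] by (simp add: loops_at_def)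
  moreover have "pathstart \<alpha> = y0" "pathfinish \<alpha> = y0" using assms by (simp_all add: loops_at_def)
  ultimately show ?thesis using pc assms h_conjugate by (simp add: path_value_def)
qed

definition chain_value :: "'b complex_chain \<Rightarrow> complex" where
  "chain_value c = (\<Sum>\<sigma> \<in> Poly_Mapping.keys c. Poly_Mapping.lookup c \<sigma> * path_value (edge_path \<sigma>))"

lemma chain_value_superset:
  assumes "finite S" "Poly_Mapping.keys c \<subseteq> S"
  shows "chain_value c = (\<Sum>\<sigma>\<in>S. Poly_Mapping.lookup c \<sigma> * path_value (edge_path \<sigma>))"
  unfolding chain_value_def using assms
  by (intro sum.mono_neutral_left) (auto simp: in_keys_iff)

lemma chain_value_zero [simp]: "chain_value 0 = 0"
  by (simp add: chain_value_def)

lemma chain_value_single [simp]: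
  "chain_value (Poly_Mapping.single \<sigma> a) = a * path_value (edge_path \<sigma>)"
  by (simp add: chain_value_superset [of "{\<sigma>}"])

lemma chain_value_add [simp]: "chain_value (c + d) = chain_value c + chain_value d"
  using Poly_Mapping.keys_add [of c d]
  by (simp add: chain_value_superset [of "Poly_Mapping.keys c \<union> Poly_Mapping.keys d"]
      lookup_add sum.distrib algebra_simps)

lemma chain_value_diff [simp]: "chain_value (c - d) = chain_value c - chain_value d"
  using chain_value_add [of "c - d" d] by (simp add: algebra_simps)

lemma chain_value_sum [simp]: "chain_value (\<Sum>i\<in>I. c i) = (\<Sum>i\<in>I. chain_value (c i))"
  by (induction I rule: infinite_finite_induct) auto

lemma chain_value_scale [simp]:
  "chain_value (Poly_Mapping.map ((*) a) c) = a * chain_value c"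
proof -
  have lookup: "Poly_Mapping.lookup (Poly_Mapping.map ((*) a) c) \<sigma> = a * Poly_Mapping.lookup c \<sigma>" for \<sigma>
    by (simp add: Poly_Mapping.map.rep_eq when_def)
  then have "Poly_Mapping.keys (Poly_Mapping.map ((*) a) c) \<subseteq> Poly_Mapping.keys c"
    by (auto simp: in_keys_iff)
  then show ?thesis
    by (simp add: chain_value_superset [of "Poly_Mapping.keys c"] lookup sum_distrib_left mult.assoc)
qed

text \<open>The alternating sum over the faces of a triangle vanishes since face \<open>1\<close> is homotopic to
  face \<open>2\<close> followed by face \<open>0\<close>.\<close>

lemma chain_value_boundary:
  assumes "b \<in> complex_boundaries 1 (top_of_set Y)"
  shows "chain_value b = 0"
proof -
  obtain c where c: "Poly_Mapping.keys c \<subseteq> singular_simplex_set 2 (top_of_set Y)"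
    and b: "b = complex_boundary 2 c"
    using assms by (auto simp: complex_boundaries_def complex_chains_def numeral_2_eq_2)
  have "path_value (edge_path (singular_face 2 1 f)) =
      path_value (edge_path (singular_face 2 2 f)) + path_value (edge_path (singular_face 2 0 f))"
    if "f \<in> Poly_Mapping.keys c" for f
  proof -
    have f: "singular_simplex 2 (top_of_set Y) f" using that c by auto
    then have faces: "singular_simplex 1 (top_of_set Y) (singular_face 2 k f)" if "k \<le> 2" for k
      using singular_simplex_singular_face [OF f] that by simp
    note hom = edge_path_triangle(1) [OF f]
    show ?thesis
      unfolding path_value_homotopic [OF hom, symmetric]
      using edge_path_singular_simplex [OF faces [of 2]] edge_path_singular_simplex [OF faces [of 0]]
        edge_path_triangle(2) [OF f]
      by (intro path_value_join) auto
  qed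
  then show ?thesis
    unfolding b complex_boundary_def
    by (simp add: numeral_2_eq_2 algebra_simps)
qed

lemma chain_value_loop_cycle:
  assumes "path \<delta>" "path_image \<delta> \<subseteq> Y"
  shows "chain_value (loop_cycle \<delta>) = path_value \<delta>"
proof -
  have "homotopic_paths Y \<delta> (edge_path (restrict (\<lambda>x. \<delta> (x 1)) (standard_simplex 1)))"
    using assms edge_in_standard_simplex
    by (intro homotopic_paths_eq) (auto simp: edge_path_def simp del: One_nat_def)
  from path_value_homotopic [OF this] show ?thesis
    by (simp add: loop_cycle_def)
qed

text \<open>The value depends on the homology class only, so its vanishing passes to spans.\<close>

lemma homology_span_chain_value:
  assumes A: "A \<in> homology_span 1 (top_of_set Y) S" and z: "z \<in> A"
    and S: "\<And>B w. B \<in> S \<Longrightarrow> w \<in> B \<Longrightarrow> chain_value w = 0"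
  shows "chain_value z = 0"
  using A z
proof (induction arbitrary: z rule: homology_span.induct)
  case span_zero
  then show ?case using chain_value_boundary [of "z - 0"] by (simp add: homology_class_def)
next
  case (span_base A)
  then show ?case using S by blast
next
  case (span_add A B)
  then obtain u v where uv: "u \<in> A" "v \<in> B" "z - (u + v) \<in> complex_boundaries 1 (top_of_set Y)"
    by (auto simp: homology_add_def homology_class_def)
  from chain_value_boundary [OF uv(3)] show ?case using uv span_add.IH by simp
next
  case (span_scale A a)
  then obtain u where u: "u \<in> A"
    "z - Poly_Mapping.map ((*) a) u \<in> complex_boundaries 1 (top_of_set Y)"
    by (auto simp: homology_scale_def homology_class_def)
  from chain_value_boundary [OF u(2)] show ?case using u span_scale.IH by simp
qed

end

lemma loop_cycle_in_complex_cycles: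
  assumes "\<delta> \<in> loops_at Y y"
  shows "loop_cycle \<delta> \<in> complex_cycles 1 (top_of_set Y)"
proof -
  let ?\<sigma> = "restrict (\<lambda>x. \<delta> (x 1)) (standard_simplex 1)"
  have "continuous_on {0..1} \<delta>" and \<delta>: "\<delta> ` {0..1} \<subseteq> Y" and ends: "\<delta> 0 = \<delta> 1"
    using assms by (auto simp: loops_at_def path_def path_image_def pathstart_def pathfinish_def)
  then have "continuous_map (top_of_set {0..1}) (top_of_set Y) \<delta>" by auto
  moreover have "continuous_map (subtopology (powertop_real UNIV) (standard_simplex 1))
      (top_of_set {0..1}) (\<lambda>x. x 1)"
    by (auto simp: continuous_map_in_subtopology standard_simplex_def
        intro!: continuous_map_from_subtopology continuous_map_product_projection
        simp del: euclidean_product_topology)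
  ultimately have "continuous_map (subtopology (powertop_real UNIV) (standard_simplex 1))
      (top_of_set Y) (\<delta> \<circ> (\<lambda>x. x 1))"
    by (rule continuous_map_compose [rotated])
  then have "continuous_map (subtopology (powertop_real UNIV) (standard_simplex 1)) (top_of_set Y) ?\<sigma>"
    by (rule continuous_map_eq) auto
  then have \<sigma>: "singular_simplex 1 (top_of_set Y) ?\<sigma>"
    by (simp add: singular_simplex_def)
  have "singular_face 1 0 ?\<sigma> = singular_face 1 1 ?\<sigma>"
  proof
    fix x
    show "singular_face 1 0 ?\<sigma> x = singular_face 1 1 ?\<sigma> x"
      using simplical_face_in_standard_simplex [of 1 0 x] simplical_face_in_standard_simplex [of 1 1 x] ends
      by (auto simp: singular_face_def simplical_face_def standard_simplex_0)
  qed
  then have "complex_boundary 1 (loop_cycle \<delta>) = 0"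
    by (simp add: complex_boundary_def loop_cycle_def flip: single_add)
  with \<sigma> show ?thesis
    by (simp add: complex_cycles_def complex_chains_def loop_cycle_def)
qed

section \<open>Primitive homology\<close>

lemma (in group) nat_pow_conjugate:
  fixes m :: nat
  assumes "x \<in> carrier G" "y \<in> carrier G"
  shows "(y \<otimes> (x \<otimes> inv y)) [^] m = y \<otimes> (x [^] m \<otimes> inv y)"
proof (induction m)
  case (Suc m)
  have "inv y \<otimes> (y \<otimes> (x \<otimes> inv y)) = x \<otimes> inv y"
    using assms by (simp flip: m_assoc)
  then show ?case
    using assms by (simp add: Suc m_assoc)
qed (use assms in simp)

lemma (in group) conjugate_eq_one_iff:
  assumes "x \<in> carrier G" "y \<in> carrier G"
  shows "y \<otimes> (x \<otimes> inv y) = \<one> \<longleftrightarrow> x = \<one>"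
proof
  assume "y \<otimes> (x \<otimes> inv y) = \<one>"
  then have "inv y \<otimes> (y \<otimes> (x \<otimes> inv y)) \<otimes> y = \<one>"
    using assms by simp
  then show "x = \<one>"
    using assms by (simp add: m_assoc) (simp flip: m_assoc)
qed (use assms in simp)

lemma loops_at_compose:
  assumes "continuous_on Y p" "p ` Y \<subseteq> X" "\<delta> \<in> loops_at Y y"
  shows "p \<circ> \<delta> \<in> loops_at X (p y)"
  using assms path_continuous_image [of \<delta> p]
  by (auto simp: loops_at_def path_image_compose pathstart_compose pathfinish_compose
      intro: continuous_on_subset)

text \<open>A coordinate of \<open>c\<close>, evaluated on the image in \<open>F\<close> of a loop in \<open>Y\<close>, is a homomorphism from
  the fundamental group of \<open>Y\<close> because those images lie in the kernel of \<open>\<phi>\<close>. An elevation of a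
  primitive loop, joined to the base point of \<open>Y\<close>, projects to a conjugate of a power of a
  primitive element, that is, to a power of an element outside the kernel; there \<open>c\<close> is zero.
  The element \<open>k\<close> supplies a loop on which the functional does not vanish.\<close>

theorem (in crossed_homomorphism) primitive_homology_proper:
  fixes X :: "'x::topological_space set" and Y :: "'y::topological_space set"
  assumes \<theta>: "\<theta> \<in> iso (fundamental_group X x0) F"
    and p: "continuous_on Y p" "p ` Y \<subseteq> X" and y0: "y0 \<in> Y" "p y0 = x0"
    and image: "(\<lambda>\<delta>. homotopy_class X (p \<circ> \<delta>)) ` loops_at Y y0 =
      kernel (fundamental_group X x0) G (\<phi> \<circ> \<theta>)"
    and primitive: "\<And>x. x \<in> carrier F \<Longrightarrow> primitive_element F x \<Longrightarrow> \<phi> x \<noteq> \<one>"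
    and k: "k \<in> kernel F G \<phi>" "c k \<noteq> (\<lambda>i. 0)"
  shows "primitive_homology X x0 Y p y0 \<noteq> complex_homology 1 (top_of_set Y)"
proof
  let ?\<pi> = "fundamental_group X x0"
  have x0: "x0 \<in> X" using p y0 by blast
  interpret \<pi>: group ?\<pi> using x0 by (rule group_fundamental_group)
  interpret \<theta>: group_hom ?\<pi> F \<theta>
    using \<theta> \<pi>.group_axioms F.group_axioms by (simp add: group_hom_def group_hom_axioms_def iso_def)
  obtain i where i: "c k i \<noteq> 0" using k(2) by auto
  define f where "f \<delta> = \<theta> (homotopy_class X (p \<circ> \<delta>))" for \<delta>
  define h where "h \<delta> = complex_of_real (c (f \<delta>) i)" for \<delta>
  have p_loop: "p \<circ> \<delta> \<in> loops_at X x0" if "\<delta> \<in> loops_at Y y0" for \<delta>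
    using loops_at_compose [OF p that] y0 by simp
  have f_kernel: "f \<delta> \<in> kernel F G \<phi>" if "\<delta> \<in> loops_at Y y0" for \<delta>
  proof -
    have "homotopy_class X (p \<circ> \<delta>) \<in> kernel ?\<pi> G (\<phi> \<circ> \<theta>)"
      unfolding image [symmetric] using that by (rule imageI)
    then show ?thesis by (simp add: kernel_def f_def)
  qed
  interpret loop_functional Y y0 h
  proof
    fix \<alpha> \<beta> assume \<alpha>: "\<alpha> \<in> loops_at Y y0"
    {
      assume "homotopic_paths Y \<alpha> \<beta>"
      then have "homotopic_paths X (p \<circ> \<alpha>) (p \<circ> \<beta>)"
        using p by (intro homotopic_paths_continuous_image) auto
      from homotopy_class_eqI [OF this] show "h \<alpha> = h \<beta>"
        by (simp add: h_def f_def)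
    }
    {
      assume \<beta>: "\<beta> \<in> loops_at Y y0"
      have "f (\<alpha> +++ \<beta>) = f \<alpha> \<otimes>\<^bsub>F\<^esub> f \<beta>"
        unfolding f_def path_compose_join fundamental_group_mult [OF p_loop [OF \<alpha>] p_loop [OF \<beta>], symmetric]
        using p_loop [OF \<alpha>] p_loop [OF \<beta>] by (simp add: homotopy_class_in_carrier)
      then show "h (\<alpha> +++ \<beta>) = h \<alpha> + h \<beta>"
        using c_kernel_mult [OF f_kernel [OF \<alpha>], of "f \<beta>"] f_kernel [OF \<beta>]
        by (simp add: h_def kernel_def)
    }
  qed
  have vanishes: "chain_value w = 0"
    if \<gamma>: "\<gamma> \<in> loops_at X x0" and prim: "primitive_element ?\<pi> (homotopy_class X \<gamma>)"
      and elev: "elevation Y p y0 \<gamma> \<epsilon>"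
      and w: "w \<in> homology_class 1 (top_of_set Y) (loop_cycle \<epsilon>)" for w \<gamma> \<epsilon>
  proof -
    obtain \<tau> \<sigma> \<delta> m where \<tau>: "homeomorphism Y Y \<tau> \<sigma>" "\<forall>y\<in>Y. p (\<tau> y) = p y"
      and \<delta>: "\<delta> \<in> loops_at Y y0" "\<forall>t\<in>{0..1}. p (\<delta> t) = loop_power \<gamma> m t" and \<epsilon>: "\<epsilon> = \<tau> \<circ> \<delta>"
      using elev by (auto simp: elevation_def deck_transformation_def preferred_elevation_def closed_lift_def)
    have \<tau>': "continuous_on Y \<tau>" "\<tau> ` Y \<subseteq> Y" using \<tau>(1) by (auto simp: homeomorphism_def)
    have \<epsilon>loop: "\<epsilon> \<in> loops_at Y (\<tau> y0)" unfolding \<epsilon> using loops_at_compose [OF \<tau>' \<delta>(1)] .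
    then have \<epsilon>': "path \<epsilon>" "path_image \<epsilon> \<subseteq> Y" "pathstart \<epsilon> = \<tau> y0" "pathfinish \<epsilon> = \<tau> y0"
      by (simp_all add: loops_at_def)
    have "chain_value w = path_value \<epsilon>"
      using chain_value_boundary [of "w - loop_cycle \<epsilon>"] chain_value_loop_cycle [OF \<epsilon>'(1,2)] w
      by (simp add: homology_class_def)
    also have "\<dots> = 0"
    proof (cases "path_component Y y0 (\<tau> y0)")
      case True
      \<comment> \<open>The path \<open>?q\<close> runs between two points over \<open>x0\<close>, so it projects to a loop.\<close>
      let ?q = "tether (\<tau> y0)" and ?g = "\<theta> (homotopy_class X \<gamma>)"
      define L where "L = ?q +++ (\<epsilon> +++ reversepath ?q)"
      have L: "L \<in> loops_at Y y0"
        unfolding L_def using tethered_loop [OF \<epsilon>'(1,2)] \<epsilon>'(3,4) True by simp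
      have q: "p \<circ> ?q \<in> loops_at X x0"
        using tether [OF True] p y0 \<tau>(2) path_continuous_image [of ?q p]
        by (auto simp: loops_at_def path_image_compose pathstart_compose pathfinish_compose
            intro: continuous_on_subset)
      have p\<epsilon>: "p \<circ> \<epsilon> \<in> loops_at X x0"
        using loops_at_compose [OF p \<epsilon>loop] \<tau>(2) y0 by simp
      have "p (\<epsilon> t) = loop_power \<gamma> m t" if "t \<in> {0..1}" for t
      proof -
        have "\<delta> t \<in> Y" using \<delta>(1) that by (auto simp: loops_at_def path_image_def)
        then show ?thesis using \<tau>(2) \<delta>(2) that by (simp add: \<epsilon>)
      qed
      then have "homotopic_paths X (p \<circ> \<epsilon>) (loop_power \<gamma> m)"
        using p\<epsilon> by (intro homotopic_paths_eq) (auto simp: loops_at_def)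
      from homotopy_class_eqI [OF this]
      have \<epsilon>class: "homotopy_class X (p \<circ> \<epsilon>) = homotopy_class X \<gamma> [^]\<^bsub>?\<pi>\<^esub> m"
        using homotopy_class_loop_power [OF \<gamma> x0] by simp
      have rev: "p \<circ> reversepath ?q = reversepath (p \<circ> ?q)"
        by (simp add: reversepath_def o_def)
      define y where "y = \<theta> (homotopy_class X (p \<circ> ?q))"
      have y: "y \<in> carrier F" unfolding y_def using q by (simp add: homotopy_class_in_carrier)
      have g: "?g \<in> carrier F" using \<gamma> by (simp add: homotopy_class_in_carrier)
      have "homotopy_class X (p \<circ> L) = homotopy_class X (p \<circ> ?q) \<otimes>\<^bsub>?\<pi>\<^esub>
          (homotopy_class X \<gamma> [^]\<^bsub>?\<pi>\<^esub> m \<otimes>\<^bsub>?\<pi>\<^esub> inv\<^bsub>?\<pi>\<^esub> (homotopy_class X (p \<circ> ?q)))"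
        unfolding L_def path_compose_join rev \<epsilon>class [symmetric]
          homotopy_class_reversepath [OF q x0, symmetric]
        using q p\<epsilon> by (simp add: fundamental_group_mult loops_at_join loops_at_reversepath)
      then have "f L = y \<otimes>\<^bsub>F\<^esub> (?g [^]\<^bsub>F\<^esub> m \<otimes>\<^bsub>F\<^esub> inv\<^bsub>F\<^esub> y)"
        using q \<gamma> by (simp add: f_def y_def homotopy_class_in_carrier \<theta>.hom_nat_pow)
      also have "\<dots> = (y \<otimes>\<^bsub>F\<^esub> (?g \<otimes>\<^bsub>F\<^esub> inv\<^bsub>F\<^esub> y)) [^]\<^bsub>F\<^esub> m"
        using F.nat_pow_conjugate [OF g y] by simp
      finally have fL: "f L = (y \<otimes>\<^bsub>F\<^esub> (?g \<otimes>\<^bsub>F\<^esub> inv\<^bsub>F\<^esub> y)) [^]\<^bsub>F\<^esub> m" .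
      have "\<phi> ?g \<noteq> \<one>"
        using primitive [OF g primitive_element_iso [OF \<pi>.group_axioms F.group_axioms \<theta> prim]] .
      then have "\<phi> (y \<otimes>\<^bsub>F\<^esub> (?g \<otimes>\<^bsub>F\<^esub> inv\<^bsub>F\<^esub> y)) \<noteq> \<one>"
        using y g conjugate_eq_one_iff [of "\<phi> ?g" "\<phi> y"] by simp
      then have "c (f L) = (\<lambda>i. 0)"
        using f_kernel [OF L] y g unfolding fL by (intro c_power_zero) auto
      then show ?thesis
        using True \<epsilon>'(3,4) by (simp add: path_value_def h_def L_def)
    next
      case False
      then show ?thesis using \<epsilon>' by (simp add: path_value_def)
    qed
    finally show ?thesis .
  qed
  have "k \<in> \<theta> ` carrier ?\<pi>"
    using \<theta> k(1) by (simp add: iso_def bij_betw_def kernel_def)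
  then obtain A where A: "A \<in> carrier ?\<pi>" "\<theta> A = k" by auto
  then have "A \<in> kernel ?\<pi> G (\<phi> \<circ> \<theta>)" using k(1) by (simp add: kernel_def)
  then obtain \<delta> where \<delta>: "\<delta> \<in> loops_at Y y0" "A = homotopy_class X (p \<circ> \<delta>)"
    unfolding image [symmetric] by auto
  have "chain_value (loop_cycle \<delta>) = h \<delta>"
    using chain_value_loop_cycle path_value_loop [OF \<delta>(1)] \<delta>(1) by (simp add: loops_at_def)
  then have nonzero: "chain_value (loop_cycle \<delta>) \<noteq> 0"
    using A \<delta> i by (simp add: h_def f_def)
  have cycle: "loop_cycle \<delta> \<in> complex_cycles 1 (top_of_set Y)"
    using \<delta>(1) by (rule loop_cycle_in_complex_cycles)
  have "complex_boundary 2 0 \<in> complex_boundaries 1 (top_of_set Y)"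
    unfolding complex_boundaries_def numeral_2_eq_2 One_nat_def
    by (rule imageI) (simp add: complex_chains_def)
  then have "0 \<in> complex_boundaries 1 (top_of_set Y)"
    by (simp add: complex_boundary_def)
  then have self: "loop_cycle \<delta> \<in> homology_class 1 (top_of_set Y) (loop_cycle \<delta>)"
    using cycle by (simp add: homology_class_def)
  assume "primitive_homology X x0 Y p y0 = complex_homology 1 (top_of_set Y)"
  then have "homology_class 1 (top_of_set Y) (loop_cycle \<delta>) \<in> primitive_homology X x0 Y p y0"
    using cycle by (simp add: complex_homology_def)
  then have "chain_value (loop_cycle \<delta>) = 0"
    unfolding primitive_homology_def
    by (rule homology_span_chain_value [OF _ self]) (use vanishes in auto)
  with nonzero show False by simp
qed

theorem proposition7p1:
  fixes F :: "('f, 'm) monoid_scheme"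
  assumes "free_group_of_rank F 2"
  shows
    "(\<exists>(G :: nat monoid) \<phi>.
        group G \<and> finite (carrier G) \<and> \<phi> \<in> epi F G \<and>
        (\<exists>N. acts_freely_linearly_on_sphere G N) \<and>
        (\<forall>x \<in> carrier F. primitive_element F x \<longrightarrow> x \<notin> kernel F G \<phi>)) \<and>
     (\<forall>(G :: ('g, 'n) monoid_scheme) \<phi> (X :: 'x::topological_space set) x0 \<theta>
        (Y :: 'y::topological_space set) p y0.
        group G \<and> finite (carrier G) \<and> \<phi> \<in> epi F G \<and>
        (\<exists>N. acts_freely_linearly_on_sphere G N) \<and>
        (\<forall>x \<in> carrier F. primitive_element F x \<longrightarrow> x \<notin> kernel F G \<phi>) \<and>
        is_graph X \<and> x0 \<in> X \<and> \<theta> \<in> iso (fundamental_group X x0) F \<and>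
        associated_cover X x0 G (\<phi> \<circ> \<theta>) Y p y0
        \<longrightarrow> primitive_homology X x0 Y p y0 \<noteq> complex_homology 1 (top_of_set Y))"
proof (intro conjI allI impI)
  obtain \<phi> where \<phi>: "\<phi> \<in> epi F quaternion_group"
    using exists_quaternion_quotient [OF assms] ..
  show "\<exists>(G :: nat monoid) \<phi>.
        group G \<and> finite (carrier G) \<and> \<phi> \<in> epi F G \<and>
        (\<exists>N. acts_freely_linearly_on_sphere G N) \<and>
        (\<forall>x \<in> carrier F. primitive_element F x \<longrightarrow> x \<notin> kernel F G \<phi>)"
  proof (intro exI conjI ballI impI)
    show "finite (carrier quaternion_group)" by (simp add: quaternion_group_def)
    show "x \<notin> kernel F quaternion_group \<phi>" if "primitive_element F x" for x
      using primitive_not_in_kernel [OF assms group_quaternion_group \<phi> quaternion_group_nonabelian that] .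
  qed (use group_quaternion_group \<phi> quaternion_group_acts_freely in auto)
next
  fix G :: "('g, 'n) monoid_scheme" and \<phi> and X :: "'x::topological_space set" and x0 \<theta>
    and Y :: "'y::topological_space set" and p y0
  assume *: "group G \<and> finite (carrier G) \<and> \<phi> \<in> epi F G \<and>
        (\<exists>N. acts_freely_linearly_on_sphere G N) \<and>
        (\<forall>x \<in> carrier F. primitive_element F x \<longrightarrow> x \<notin> kernel F G \<phi>) \<and>
        is_graph X \<and> x0 \<in> X \<and> \<theta> \<in> iso (fundamental_group X x0) F \<and>
        associated_cover X x0 G (\<phi> \<circ> \<theta>) Y p y0"
  then have G: "group G" "finite (carrier G)" and hom: "\<phi> \<in> hom F G" and surj: "\<phi> ` carrier F = carrier G"
    and \<theta>: "\<theta> \<in> iso (fundamental_group X x0) F"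
    by (auto simp: epi_def)
  have primitive: "\<phi> x \<noteq> \<one>\<^bsub>G\<^esub>" if "x \<in> carrier F" "primitive_element F x" for x
    using * that by (auto simp: kernel_def)
  obtain N \<rho> where "linear_representation G (Suc N) \<rho>"
    "\<forall>g \<in> carrier G. g \<noteq> \<one>\<^bsub>G\<^esub> \<longrightarrow> (\<forall>x \<in> topspace (nsphere N). \<rho> g x \<noteq> x)"
    using * by (auto simp: acts_freely_linearly_on_sphere_def)
  then interpret free_sphere_representation G N \<rho>
    using G(1) by (simp add: free_sphere_representation_def free_sphere_representation_axioms_def)
  obtain B where B: "free_basis F B" "card B = 2" and F: "group F"
    using assms by (auto simp: free_group_of_rank_def)
  obtain a b where ab: "B = {a, b}" "a \<noteq> b" using B(2) by (auto simp: card_2_iff)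
  have carrier: "a \<in> carrier F" "b \<in> carrier F" using B(1) ab by (auto simp: free_basis_def)
  \<comment> \<open>Any nonzero vector would do for the value at \<open>b\<close>; the value \<open>0\<close> at \<open>a\<close>, which acts without
    nonzero fixed vectors, keeps the crossed homomorphism from being principal.\<close>
  define e :: "nat \<Rightarrow> real" where "e = (\<lambda>i. if i = 0 then 1 else 0)"
  have "(\<lambda>x. if x = a then (\<lambda>i. 0) else e) \<in> B \<rightarrow> E"
    by (auto simp: e_def topspace_Euclidean_space)
  from exists_crossed_homomorphism [OF F B(1) hom this]
  obtain c where c: "crossed_homomorphism G N \<rho> F \<phi> c" "c a = (\<lambda>i. 0)" "c b = e"
    using ab by auto
  interpret crossed_homomorphism G N \<rho> F \<phi> c by (rule c(1))
  have "primitive_element F a" using B(1) ab by (auto simp: primitive_element_def)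
  then have "\<phi> a \<noteq> \<one>\<^bsub>G\<^esub>" using primitive carrier by blast
  moreover have "c b \<noteq> (\<lambda>i. 0)" by (auto simp: c(3) e_def fun_eq_iff)
  ultimately obtain k where k: "k \<in> kernel F G \<phi>" "c k \<noteq> (\<lambda>i. 0)"
    using vanishing_on_kernel_imp_zero [OF surj G(2) _ carrier(1) _ c(2) carrier(2)] by metis
  have cover: "continuous_on Y p" "p ` Y \<subseteq> X" "y0 \<in> Y" "p y0 = x0"
    "(\<lambda>\<delta>. homotopy_class X (p \<circ> \<delta>)) ` loops_at Y y0 =
      kernel (fundamental_group X x0) G (\<phi> \<circ> \<theta>)"
    using * by (auto simp: associated_cover_def covering_space_def)
  show "primitive_homology X x0 Y p y0 \<noteq> complex_homology 1 (top_of_set Y)"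
    by (rule primitive_homology_proper [OF \<theta> cover primitive k])
qed

end
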